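(* Assume the Strong Exponential Time Hypothesis (SETH). Then there is no $\varepsilon > 0$ such that \textsc{Independent Set}, restricted to inputs consisting of a planar graph $G$ together with a linear layout of $G$ of cutwidth $k$ (and the integer $t$), can be solved in time $\mathcal{O}^*((2-\varepsilon)^k)$.
   Context: All graphs are finite, simple and undirected. \textsc{Independent Set}: given a graph $G$ and an integer $t$, decide whether $G$ has an independent set (a set of pairwise nonadjacent vertices) of size $t$. A graph is planar if it has a drawing in the plane in which the curves representing edges intersect only at common endpoints. For an $n$-vertex graph $G$, a linear layout is a bijection $\pi\colon V(G)\to[n]$; its cutwidth is $\mathrm{ctw}_\pi(G)=\max_{1\le i<n}|\{\{u,v\}\in E(G): \pi(u)\le i<\pi(v)\}|$. The notation $\mathcal{O}^*(f(k))$ means $\mathcal{O}(f(k)\cdot N^{\mathcal{O}(1)})$ where $N$ is the input size. SETH: for every $\varepsilon>0$ there is a constant $q$ such that $q$-SAT (satisfiability of CNF formulas with clauses of size at most $q$) on $n$ variables cannot be solved in time $\mathcal{O}^*((2-\varepsilon)^n)$. *)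

theory Defs
  imports "HOL-Analysis.Analysis"
begin

section \<open>Model of computation\<close>

text \<open>
  Algorithms are programs of Jones's WHILE language over binary trees (N. D. Jones,
  Computability and Complexity: From a Programming Perspective).  Every assignment and every
  test costs one unit; since a program contains finitely many expressions and trees can be stored
  with sharing, a run of length T is simulated by a Turing machine in time polynomial in T and the
  input size, and conversely.  Hence the model agrees with Turing machines and
  with random access machines up to the polynomial factors hidden by O*.
\<close>

datatype data = Leaf | Node data data

fun data_size :: "data \<Rightarrow> nat" where
  "data_size Leaf = 1"
| "data_size (Node l r) = 1 + data_size l + data_size r"

fun left :: "data \<Rightarrow> data" where
  "left Leaf = Leaf"
| "left (Node l r) = l"

fun right :: "data \<Rightarrow> data" where
  "right Leaf = Leaf"
| "right (Node l r) = r"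

datatype expr = Var nat | LeafE | NodeE expr expr | LeftE expr | RightE expr

type_synonym store = "nat \<Rightarrow> data"

fun eval_expr :: "expr \<Rightarrow> store \<Rightarrow> data" where
  "eval_expr (Var x) s = s x"
| "eval_expr LeafE s = Leaf"
| "eval_expr (NodeE e1 e2) s = Node (eval_expr e1 s) (eval_expr e2 s)"
| "eval_expr (LeftE e) s = left (eval_expr e s)"
| "eval_expr (RightE e) s = right (eval_expr e s)"

datatype prog =
    Skip
  | Assign nat expr
  | Seq prog prog
  | If expr prog prog
  | While expr prog

text \<open>\<open>exec c s T s'\<close>: started in \<open>s\<close>, program \<open>c\<close> halts after \<open>T\<close> steps in \<open>s'\<close>.
  A test succeeds iff its value is not \<open>Leaf\<close>.\<close>

inductive exec :: "prog \<Rightarrow> store \<Rightarrow> nat \<Rightarrow> store \<Rightarrow> bool" where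
  Skip: "exec Skip s 1 s"
| Assign: "exec (Assign x e) s 1 (s(x := eval_expr e s))"
| Seq: "exec c1 s T1 s' \<Longrightarrow> exec c2 s' T2 s'' \<Longrightarrow> exec (Seq c1 c2) s (T1 + T2) s''"
| IfTrue: "eval_expr e s \<noteq> Leaf \<Longrightarrow> exec c1 s T s' \<Longrightarrow> exec (If e c1 c2) s (1 + T) s'"
| IfFalse: "eval_expr e s = Leaf \<Longrightarrow> exec c2 s T s' \<Longrightarrow> exec (If e c1 c2) s (1 + T) s'"
| WhileFalse: "eval_expr e s = Leaf \<Longrightarrow> exec (While e c) s 1 s"
| WhileTrue: "eval_expr e s \<noteq> Leaf \<Longrightarrow> exec c s T1 s' \<Longrightarrow> exec (While e c) s' T2 s'' \<Longrightarrow>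
    exec (While e c) s (1 + T1 + T2) s''"

inductive_cases exec_SkipE: "exec Skip s T s'"
inductive_cases exec_AssignE: "exec (Assign x e) s T s'"
inductive_cases exec_SeqE: "exec (Seq c1 c2) s T s'"
inductive_cases exec_IfE: "exec (If e c1 c2) s T s'"
inductive_cases exec_WhileE: "exec (While e c) s T s'"

lemma exec_deterministic:
  "exec c s T s' \<Longrightarrow> exec c s U t' \<Longrightarrow> T = U \<and> s' = t'"
proof (induction arbitrary: U t' rule: exec.induct)
  case (Skip s)
  then show ?case by (auto elim: exec_SkipE)
next
  case (Assign x e s)
  then show ?case by (auto elim: exec_AssignE)
next
  case (Seq c1 s T1 s' c2 T2 s'')
  from Seq.prems obtain V1 V2 u where "U = V1 + V2" "exec c1 s V1 u" "exec c2 u V2 t'"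
    by (elim exec_SeqE) blast
  then show ?case using Seq.IH(1)[of V1 u] Seq.IH(2)[of V2 t'] by simp
next
  case (IfTrue e s c1 T s' c2)
  from IfTrue.prems IfTrue.hyps obtain V where "U = 1 + V" "exec c1 s V t'"
    by (elim exec_IfE) auto
  then show ?case using IfTrue.IH[of V t'] by simp
next
  case (IfFalse e s c2 T s' c1)
  from IfFalse.prems IfFalse.hyps obtain V where "U = 1 + V" "exec c2 s V t'"
    by (elim exec_IfE) auto
  then show ?case using IfFalse.IH[of V t'] by simp
next
  case (WhileFalse e s c)
  from WhileFalse.prems show ?case by (rule exec_WhileE) (use WhileFalse.hyps in simp_all)
next
  case (WhileTrue e s c T1 s' T2 s'')
  from WhileTrue.prems obtain V1 V2 u
    where "U = 1 + V1 + V2" "exec c s V1 u" "exec (While e c) u V2 t'"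
    by (rule exec_WhileE) (use WhileTrue.hyps(1) in simp_all)
  then show ?case using WhileTrue.IH(1)[of V1 u] WhileTrue.IH(2)[of V2 t'] by simp
qed

text \<open>Variable 0 holds the input at the start (all others hold \<open>Leaf\<close>) and the answer at the
  end, any tree but \<open>Leaf\<close> meaning yes.\<close>

definition initial_store :: "data \<Rightarrow> store" where
  "initial_store d = (\<lambda>_. Leaf)(0 := d)"

text \<open>
  The problem with input set \<open>I\<close>, encoding \<open>enc\<close>, yes-instances \<open>yes\<close> and parameter \<open>par\<close> is
  solvable in time O*(f(par)).  Nothing is required of the algorithm outside \<open>I\<close>.
\<close>

definition solvable_Ostar ::
  "'i set \<Rightarrow> ('i \<Rightarrow> data) \<Rightarrow> ('i \<Rightarrow> bool) \<Rightarrow> ('i \<Rightarrow> nat) \<Rightarrow> (nat \<Rightarrow> real) \<Rightarrow> bool" where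
  "solvable_Ostar I enc yes par f \<longleftrightarrow>
     (\<exists>(c :: prog) (C :: real) (d :: nat). \<forall>x\<in>I. \<exists>T s.
        exec c (initial_store (enc x)) T s \<and>
        (s 0 \<noteq> Leaf \<longleftrightarrow> yes x) \<and>
        real T \<le> C * f (par x) * real (data_size (enc x)) ^ d)"

text \<open>
  Numbers are encoded in unary.  They are names of vertices or variables below the vertex or
  variable count \<open>n\<close>, this count itself, positions in a layout, and the target size, where
  targets above \<open>n\<close> are trivial.  So, compared with binary, sizes change by at most a factor
  polynomial in \<open>n\<close>; it is polynomial in the size of a graph with layout, and a formula with
  many unused variables only incurs a factor absorbed by a smaller \<open>\<epsilon>\<close> in SETH.
\<close>

fun enc_nat :: "nat \<Rightarrow> data" where
  "enc_nat 0 = Leaf"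
| "enc_nat (Suc n) = Node Leaf (enc_nat n)"

fun enc_bool :: "bool \<Rightarrow> data" where
  "enc_bool False = Leaf"
| "enc_bool True = Node Leaf Leaf"

fun enc_list :: "('a \<Rightarrow> data) \<Rightarrow> 'a list \<Rightarrow> data" where
  "enc_list f [] = Leaf"
| "enc_list f (x # xs) = Node (f x) (enc_list f xs)"

fun enc_pair :: "('a \<Rightarrow> data) \<Rightarrow> ('b \<Rightarrow> data) \<Rightarrow> 'a \<times> 'b \<Rightarrow> data" where
  "enc_pair f g (x, y) = Node (f x) (g y)"


section \<open>Satisfiability and SETH\<close>

text \<open>The literal \<open>(b, x)\<close> is the variable \<open>x\<close> if \<open>b\<close> holds and its negation otherwise.\<close>

type_synonym literal = "bool \<times> nat"
type_synonym clause = "literal list"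

text \<open>A formula on the variables \<open>0, \<dots>, n - 1\<close>.\<close>

datatype cnf = CNF (num_vars: nat) (clauses: "clause list")

definition satisfies :: "(nat \<Rightarrow> bool) \<Rightarrow> clause list \<Rightarrow> bool" where
  "satisfies a F \<longleftrightarrow> (\<forall>c\<in>set F. \<exists>(b, x)\<in>set c. a x = b)"

definition satisfiable :: "cnf \<Rightarrow> bool" where
  "satisfiable \<phi> \<longleftrightarrow> (\<exists>a. satisfies a (clauses \<phi>))"

definition qSAT_inputs :: "nat \<Rightarrow> cnf set" where
  "qSAT_inputs q =
     {\<phi>. \<forall>c\<in>set (clauses \<phi>). length c \<le> q \<and> (\<forall>(b, x)\<in>set c. x < num_vars \<phi>)}"

definition enc_cnf :: "cnf \<Rightarrow> data" where
  "enc_cnf \<phi> = enc_pair enc_nat (enc_list (enc_list (enc_pair enc_bool enc_nat)))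
     (num_vars \<phi>, clauses \<phi>)"

definition SETH :: bool where
  "SETH \<longleftrightarrow> (\<forall>\<epsilon>::real. \<epsilon> > 0 \<longrightarrow>
     (\<exists>q. \<not> solvable_Ostar (qSAT_inputs q) enc_cnf satisfiable num_vars (\<lambda>n. (2 - \<epsilon>) ^ n)))"


section \<open>Graphs\<close>

definition simple_graph :: "'a set \<Rightarrow> 'a set set \<Rightarrow> bool" where
  "simple_graph V E \<longleftrightarrow> finite V \<and> (\<forall>e\<in>E. \<exists>u\<in>V. \<exists>v\<in>V. u \<noteq> v \<and> e = {u, v})"

definition independent_set :: "'a set \<Rightarrow> 'a set set \<Rightarrow> 'a set \<Rightarrow> bool" where
  "independent_set V E S \<longleftrightarrow> S \<subseteq> V \<and> pairwise (\<lambda>u v. {u, v} \<notin> E) S"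

definition plane_drawing ::
  "'a set \<Rightarrow> 'a set set \<Rightarrow> ('a \<Rightarrow> real \<times> real) \<Rightarrow> ('a set \<Rightarrow> real \<Rightarrow> real \<times> real) \<Rightarrow> bool" where
  "plane_drawing V E p \<gamma> \<longleftrightarrow>
     inj_on p V \<and>
     (\<forall>e\<in>E. arc (\<gamma> e) \<and> {pathstart (\<gamma> e), pathfinish (\<gamma> e)} = p ` e
        \<and> path_image (\<gamma> e) \<inter> p ` V = p ` e) \<and>
     (\<forall>e\<in>E. \<forall>f\<in>E. e \<noteq> f \<longrightarrow> path_image (\<gamma> e) \<inter> path_image (\<gamma> f) \<subseteq> p ` (e \<inter> f))"

definition planar :: "'a set \<Rightarrow> 'a set set \<Rightarrow> bool" where
  "planar V E \<longleftrightarrow> (\<exists>p \<gamma>. plane_drawing V E p \<gamma>)"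

definition linear_layout :: "'a set \<Rightarrow> ('a \<Rightarrow> nat) \<Rightarrow> bool" where
  "linear_layout V \<pi> \<longleftrightarrow> bij_betw \<pi> V {1..card V}"

text \<open>The inserted 0 only matters for graphs with at most one vertex, where no cut exists.\<close>

definition cutwidth :: "'a set \<Rightarrow> 'a set set \<Rightarrow> ('a \<Rightarrow> nat) \<Rightarrow> nat" where
  "cutwidth V E \<pi> = Max (insert 0
     ((\<lambda>i. card {e\<in>E. \<exists>u v. e = {u, v} \<and> \<pi> u \<le> i \<and> i < \<pi> v}) ` {1..<card V}))"


section \<open>Independent Set on planar graphs with a given layout\<close>

text \<open>
  An instance has vertices \<open>0, \<dots>, n - 1\<close>, each edge listed once as a pair with increasing
  entries, the layout as the list of the positions of the vertices, and the target size.
\<close>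

datatype is_instance =
  IS_Instance (num_verts: nat) (edge_list: "(nat \<times> nat) list") (positions: "nat list") (target: nat)

definition verts :: "is_instance \<Rightarrow> nat set" where
  "verts x = {..<num_verts x}"

definition edges :: "is_instance \<Rightarrow> nat set set" where
  "edges x = {{u, v} | u v. (u, v) \<in> set (edge_list x)}"

definition layout :: "is_instance \<Rightarrow> nat \<Rightarrow> nat" where
  "layout x v = positions x ! v"

definition has_independent_set :: "is_instance \<Rightarrow> bool" where
  "has_independent_set x \<longleftrightarrow> (\<exists>S. independent_set (verts x) (edges x) S \<and> card S = target x)"

definition instance_cutwidth :: "is_instance \<Rightarrow> nat" where
  "instance_cutwidth x = cutwidth (verts x) (edges x) (layout x)"

definition planar_layout_inputs :: "is_instance set" where
  "planar_layout_inputs = {x.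
     distinct (edge_list x) \<and> (\<forall>(u, v)\<in>set (edge_list x). u < v) \<and>
     length (positions x) = num_verts x \<and>
     simple_graph (verts x) (edges x) \<and>
     planar (verts x) (edges x) \<and>
     linear_layout (verts x) (layout x)}"

definition enc_instance :: "is_instance \<Rightarrow> data" where
  "enc_instance x =
     enc_pair enc_nat (enc_pair (enc_list (enc_pair enc_nat enc_nat)) (enc_pair (enc_list enc_nat) enc_nat))
       (num_verts x, edge_list x, positions x, target x)"

end

(*
A CNF formula on n variables becomes a grid of planar tiles: one row per variable and one column per
clause, with the clause list repeated n + 1 times. A tile lets the value of the variable pass from
left to right and the signal "clause not yet satisfied" from top to bottom, through a planar crossover
gadget, and stops the signal if the literal is true. Neighbouring columns are joined by a single edge
per variable, so numbering the vertices column by column gives a layout of cutwidth n + O(1). A single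
edge forces the value only to be monotone along the row; since each of the n variables can change at
most once, one of the n + 1 copies of the clause list sees a constant assignment. Straight-line segments
with integer coordinates that repeat from tile to tile give a plane drawing. That the reduction
runs in polynomial time follows from closure properties of polynomial-time functions on trees, the
main one being iteration over a list when the intermediate results stay polynomially bounded.
*)

theory Submission
  imports Defs
begin

section \<open>Polynomial-time functions on trees\<close>

text \<open>The coefficient of n in the cutwidth must be exactly 1: a cutwidth of c * n with c > 1
  would only exclude bases below 2^(1/c). This leaves one edge per variable between columns, while
  forcing full agreement of two value pairs would take two. Monotone rows are the price, and the
  repetition of the clause list costs only a polynomial factor in size. The additive constant comes
  from the edges within a column. They span at most 19 positions of the layout, so at most 19 * 19
  of them straddle a cut; in the running time this is a constant factor. The target size is the
  largest conceivable one, 8 per tile and 1 for each of the two end vertices of a column. Reaching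
  it makes every tile tight, and tightness is what turns missing vertices into forced ones: edges
  alone can only forbid.\<close>

definition polybounded :: "(data \<Rightarrow> nat) \<Rightarrow> bool" where
  "polybounded B \<longleftrightarrow> (\<exists>C d. \<forall>x. B x \<le> C * data_size x ^ d)"

lemma data_size_pos [simp]: "data_size x > 0"
  by (cases x) auto

lemma data_size_ge_1: "Suc 0 \<le> data_size x"
  using data_size_pos[of x] by linarith

lemma polybounded_mono:
  assumes "polybounded B" "\<And>x. A x \<le> B x"
  shows "polybounded A"
  using assms unfolding polybounded_def by (meson order_trans)

lemma polybounded_const [intro]: "polybounded (\<lambda>_. n)"
  unfolding polybounded_def by (rule exI[of _ n], rule exI[of _ 0]) simp

lemma polybounded_size [intro]: "polybounded data_size"
  unfolding polybounded_def by (rule exI[of _ 1], rule exI[of _ 1]) simp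

text \<open>Sizes are at least 1, so both monomials are dominated by the one with exponent
  \<open>d + e\<close>; hence a single monomial suffices as the normal form of a polynomial
  bound.\<close>

lemma polybounded_add [intro]:
  assumes "polybounded A" "polybounded B"
  shows "polybounded (\<lambda>x. A x + B x)"
proof -
  obtain C d where A: "\<And>x. A x \<le> C * data_size x ^ d" using assms(1) unfolding polybounded_def by blast
  obtain D e where B: "\<And>x. B x \<le> D * data_size x ^ e" using assms(2) unfolding polybounded_def by blast
  have "A x + B x \<le> (C + D) * data_size x ^ (d + e)" for x
  proof -
    have "data_size x ^ d \<le> data_size x ^ (d + e)" "data_size x ^ e \<le> data_size x ^ (d + e)"
      using data_size_ge_1[of x] by (auto intro: power_increasing)
    then show ?thesis
      using A[of x] B[of x] unfolding add_mult_distrib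
      by (meson add_mono mult_le_mono2 order_trans)
  qed
  then show ?thesis unfolding polybounded_def by blast
qed

lemma polybounded_mult [intro]:
  assumes "polybounded A" "polybounded B"
  shows "polybounded (\<lambda>x. A x * B x)"
proof -
  obtain C d where A: "\<And>x. A x \<le> C * data_size x ^ d" using assms(1) unfolding polybounded_def by blast
  obtain D e where B: "\<And>x. B x \<le> D * data_size x ^ e" using assms(2) unfolding polybounded_def by blast
  have "A x * B x \<le> (C * D) * data_size x ^ (d + e)" for x
    using mult_le_mono[OF A[of x] B[of x]] by (simp add: power_add mult_ac)
  then show ?thesis unfolding polybounded_def by blast
qed

lemma polybounded_Suc [intro]: "polybounded A \<Longrightarrow> polybounded (\<lambda>x. Suc (A x))"
  using polybounded_add[OF polybounded_const[of 1], of A] by simp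

lemma polybounded_power [intro]: "polybounded A \<Longrightarrow> polybounded (\<lambda>x. A x ^ m)"
  by (induction m) auto

lemma polybounded_comp:
  assumes "polybounded A" "polybounded (\<lambda>x. data_size (f x))"
  shows "polybounded (\<lambda>x. A (f x))"
proof -
  obtain C d where A: "\<And>x. A x \<le> C * data_size x ^ d" using assms(1) unfolding polybounded_def by blast
  obtain D e where B: "\<And>x. data_size (f x) \<le> D * data_size x ^ e"
    using assms(2) unfolding polybounded_def by blast
  have "A (f x) \<le> (C * D ^ d) * data_size x ^ (e * d)" for x
  proof -
    have "A (f x) \<le> C * data_size (f x) ^ d" by (rule A)
    also have "\<dots> \<le> C * (D * data_size x ^ e) ^ d" by (intro mult_le_mono2 power_mono B) simp
    finally show ?thesis by (simp add: power_mult_distrib power_mult[symmetric] mult_ac)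
  qed
  then show ?thesis unfolding polybounded_def by blast
qed

text \<open>The frame condition makes the programs composable: whatever a program does not use survives.\<close>

definition computes :: "prog \<Rightarrow> nat \<Rightarrow> (data \<Rightarrow> nat) \<Rightarrow> (data \<Rightarrow> data) \<Rightarrow> bool" where
  "computes c k t f \<longleftrightarrow> k > 0 \<and> (\<forall>s. \<exists>T s'. exec c s T s' \<and> s' 0 = f (s 0) \<and>
     (\<forall>x\<ge>k. s' x = s x) \<and> T \<le> t (s 0))"

text \<open>The size of the result is bounded separately because time does not bound it
  polynomially: assigning \<open>NodeE (Var 0) (Var 0)\<close> more than doubles a tree in one
  step.\<close>

definition polytime :: "(data \<Rightarrow> data) \<Rightarrow> bool" where
  "polytime f \<longleftrightarrow> polybounded (\<lambda>x. data_size (f x)) \<and>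
     (\<exists>c k t. polybounded t \<and> computes c k t f)"

lemma polytime_size: "polytime f \<Longrightarrow> polybounded (\<lambda>x. data_size (f x))"
  by (simp add: polytime_def)

lemma computes_mono: "computes c k t f \<Longrightarrow> k \<le> k' \<Longrightarrow> computes c k' t f"
  unfolding computes_def by (meson order_trans less_le_trans)

lemma computesD:
  assumes "computes c k t f"
  obtains T s' where "exec c s T s'" "s' 0 = f (s 0)" "\<And>x. x \<ge> k \<Longrightarrow> s' x = s x" "T \<le> t (s 0)"
  using assms unfolding computes_def by blast

lemma polytimeI:
  assumes "polybounded (\<lambda>x. data_size (f x))" "polybounded t" "k > 0"
    and "\<And>s. \<exists>T s'. exec c s T s' \<and> s' 0 = f (s 0) \<and> (\<forall>x\<ge>k. s' x = s x) \<and> T \<le> t (s 0)"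
  shows "polytime f"
  using assms unfolding polytime_def computes_def by blast

lemma polytime_expr:
  assumes "\<And>s. eval_expr e s = f (s 0)" "polybounded (\<lambda>x. data_size (f x))"
  shows "polytime f"
proof (rule polytimeI[where c = "Assign 0 e" and k = 1 and t = "\<lambda>_. 1"])
  fix s :: store
  have "exec (Assign 0 e) s 1 (s(0 := eval_expr e s))" by (rule exec.Assign)
  then show "\<exists>T s'. exec (Assign 0 e) s T s' \<and> s' 0 = f (s 0) \<and> (\<forall>x\<ge>1. s' x = s x) \<and> T \<le> 1"
    using assms by (intro exI[of _ 1] exI[of _ "s(0 := eval_expr e s)"]) simp
qed (use assms in auto)

lemma polytime_id: "polytime (\<lambda>x. x)"
  by (rule polytime_expr[where e = "Var 0"]) auto

lemma data_size_left: "data_size (left x) \<le> data_size x"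
  by (cases x) auto

lemma data_size_right: "data_size (right x) \<le> data_size x"
  by (cases x) auto

lemma polytime_left: "polytime left"
  by (rule polytime_expr[where e = "LeftE (Var 0)"])
     (auto intro: polybounded_mono[OF polybounded_size] data_size_left)

lemma polytime_right: "polytime right"
  by (rule polytime_expr[where e = "RightE (Var 0)"])
     (auto intro: polybounded_mono[OF polybounded_size] data_size_right)

fun expr_of :: "data \<Rightarrow> expr" where
  "expr_of Leaf = LeafE"
| "expr_of (Node l r) = NodeE (expr_of l) (expr_of r)"

lemma eval_expr_of [simp]: "eval_expr (expr_of d) s = d"
  by (induction d) auto

lemma polytime_const: "polytime (\<lambda>_. d)"
  by (rule polytime_expr[where e = "expr_of d"]) auto

lemma polytime_comp:
  assumes "polytime f" "polytime g"
  shows "polytime (\<lambda>x. g (f x))"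
proof -
  obtain c k t where f: "polybounded t" "computes c k t f" using assms(1) unfolding polytime_def by blast
  obtain c' k' t' where g: "polybounded t'" "computes c' k' t' g" using assms(2) unfolding polytime_def by blast
  let ?k = "max k k'"
  show ?thesis
  proof (rule polytimeI[where c = "Seq c c'" and k = ?k and t = "\<lambda>x. t x + t' (f x)"])
    show "polybounded (\<lambda>x. data_size (g (f x)))"
      using polybounded_comp[OF polytime_size[OF assms(2)] polytime_size[OF assms(1)]] .
    show "polybounded (\<lambda>x. t x + t' (f x))"
      by (intro polybounded_add f polybounded_comp[OF g(1)] polytime_size assms)
    show "0 < ?k" using f(2) unfolding computes_def by auto
    fix s :: store
    obtain T s' where 1: "exec c s T s'" "s' 0 = f (s 0)" "\<And>x. x \<ge> k \<Longrightarrow> s' x = s x" "T \<le> t (s 0)"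
      by (rule computesD[OF f(2), where s = "s"]) blast
    obtain T' s'' where 2: "exec c' s' T' s''" "s'' 0 = g (s' 0)"
      "\<And>x. x \<ge> k' \<Longrightarrow> s'' x = s' x" "T' \<le> t' (s' 0)"
      by (rule computesD[OF g(2), where s = "s'"]) blast
    show "\<exists>T s'. exec (Seq c c') s T s' \<and> s' 0 = g (f (s 0)) \<and> (\<forall>x\<ge>?k. s' x = s x) \<and>
        T \<le> t (s 0) + t' (f (s 0))"
      using exec.Seq[OF 1(1) 2(1)] 1 2 by (intro exI[of _ "T + T'"] exI[of _ s'']) auto
  qed
qed

lemma polytime_Node:
  assumes "polytime f" "polytime g"
  shows "polytime (\<lambda>x. Node (f x) (g x))"
proof -
  obtain c k0 t where f: "polybounded t" "computes c k0 t f" using assms(1) unfolding polytime_def by blast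
  obtain c' k1 t' where g: "polybounded t'" "computes c' k1 t' g" using assms(2) unfolding polytime_def by blast
  define k where "k = max k0 k1"
  have c: "computes c k t f" "computes c' k t' g" "k > 0"
    using computes_mono[OF f(2), of k] computes_mono[OF g(2), of k] f(2)
    by (auto simp: k_def computes_def)
  let ?p = "Seq (Assign k (Var 0)) (Seq c (Seq (Assign (k + 1) (Var 0)) (Seq (Assign 0 (Var k))
    (Seq c' (Assign 0 (NodeE (Var (k + 1)) (Var 0)))))))"
  show ?thesis
  proof (rule polytimeI[where c = ?p and k = "k + 2" and t = "\<lambda>x. t x + t' x + 4"])
    show "polybounded (\<lambda>x. data_size (Node (f x) (g x)))"
      using polytime_size[OF assms(1)] polytime_size[OF assms(2)] by auto
    show "polybounded (\<lambda>x. t x + t' x + 4)" by (intro polybounded_add polybounded_const f(1) g(1))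
    show "0 < k + 2" by simp
    fix s :: store
    let ?s1 = "s(k := s 0)"
    have e1: "exec (Assign k (Var 0)) s 1 ?s1" using exec.Assign[of k "Var 0" s] by simp
    obtain T s2 where 1: "exec c ?s1 T s2" "s2 0 = f (?s1 0)"
      "\<And>x. x \<ge> k \<Longrightarrow> s2 x = ?s1 x" "T \<le> t (?s1 0)"
      by (rule computesD[OF c(1), where s = "?s1"]) blast
    let ?s3 = "s2(k + 1 := s2 0)"
    let ?s4 = "?s3(0 := ?s3 k)"
    have e2: "exec (Assign (k + 1) (Var 0)) s2 1 ?s3" using exec.Assign[of "k+1" "Var 0" s2] by simp
    have e3: "exec (Assign 0 (Var k)) ?s3 1 ?s4" using exec.Assign[of 0 "Var k" ?s3] by simp
    obtain T' s5 where 2: "exec c' ?s4 T' s5" "s5 0 = g (?s4 0)"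
      "\<And>x. x \<ge> k \<Longrightarrow> s5 x = ?s4 x" "T' \<le> t' (?s4 0)"
      by (rule computesD[OF c(2), where s = "?s4"]) blast
    let ?s6 = "s5(0 := Node (s5 (k + 1)) (s5 0))"
    have e4: "exec (Assign 0 (NodeE (Var (k + 1)) (Var 0))) s5 1 ?s6"
      using exec.Assign[of 0 "NodeE (Var (k + 1)) (Var 0)" s5] by simp
    have ex: "exec ?p s (1 + (T + (1 + (1 + (T' + 1))))) ?s6"
      by (rule exec.Seq[OF e1 exec.Seq[OF 1(1) exec.Seq[OF e2 exec.Seq[OF e3 exec.Seq[OF 2(1) e4]]]]])
    have "?s1 0 = s 0" using c(3) by simp
    moreover have "?s4 0 = s 0" using c(3) 1(3)[of k] by simp
    ultimately show "\<exists>T s'. exec ?p s T s' \<and> s' 0 = Node (f (s 0)) (g (s 0)) \<and>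
        (\<forall>x\<ge>k+2. s' x = s x) \<and> T \<le> t (s 0) + t' (s 0) + 4"
      using ex 1 2 c(3) by (intro exI[of _ "1 + (T + (1 + (1 + (T' + 1))))"] exI[of _ ?s6]) auto
  qed
qed

lemma polytime_If:
  assumes "polytime b" "polytime f" "polytime g"
  shows "polytime (\<lambda>x. if b x \<noteq> Leaf then f x else g x)"
proof -
  obtain cb kb tb where b: "polybounded tb" "computes cb kb tb b" using assms(1) unfolding polytime_def by blast
  obtain c k0 t where f: "polybounded t" "computes c k0 t f" using assms(2) unfolding polytime_def by blast
  obtain c' k1 t' where g: "polybounded t'" "computes c' k1 t' g" using assms(3) unfolding polytime_def by blast
  define k where "k = max kb (max k0 k1)"
  have c: "computes cb k tb b" "computes c k t f" "computes c' k t' g" "k > 0"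
    using computes_mono[OF b(2), of k] computes_mono[OF f(2), of k] computes_mono[OF g(2), of k] b(2)
    by (auto simp: k_def computes_def)
  let ?i = "If (Var (k + 1)) c c'"
  let ?p = "Seq (Assign k (Var 0)) (Seq cb (Seq (Assign (k + 1) (Var 0)) (Seq (Assign 0 (Var k)) ?i)))"
  show ?thesis
  proof (rule polytimeI[where c = ?p and k = "k + 2" and t = "\<lambda>x. tb x + t x + t' x + 4"])
    show "polybounded (\<lambda>x. data_size (if b x \<noteq> Leaf then f x else g x))"
      by (rule polybounded_mono[OF polybounded_add[OF polytime_size[OF assms(2)]
            polytime_size[OF assms(3)]]]) auto
    show "polybounded (\<lambda>x. tb x + t x + t' x + 4)" by (intro polybounded_add polybounded_const f(1) g(1) b(1))
    show "0 < k + 2" by simp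
    fix s :: store
    let ?s1 = "s(k := s 0)"
    have e1: "exec (Assign k (Var 0)) s 1 ?s1" using exec.Assign[of k "Var 0" s] by simp
    obtain T s2 where 1: "exec cb ?s1 T s2" "s2 0 = b (?s1 0)"
      "\<And>x. x \<ge> k \<Longrightarrow> s2 x = ?s1 x" "T \<le> tb (?s1 0)"
      by (rule computesD[OF c(1), where s = "?s1"]) blast
    let ?s3 = "s2(k + 1 := s2 0)"
    let ?s4 = "?s3(0 := ?s3 k)"
    have e2: "exec (Assign (k + 1) (Var 0)) s2 1 ?s3" using exec.Assign[of "k+1" "Var 0" s2] by simp
    have e3: "exec (Assign 0 (Var k)) ?s3 1 ?s4" using exec.Assign[of 0 "Var k" ?s3] by simp
    have s1: "?s1 0 = s 0" using c(4) by simp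
    have s4: "?s4 0 = s 0" "?s4 (k + 1) = b (s 0)" using c(4) 1(2) 1(3)[of k] by simp_all
    have "\<exists>T' s5. exec ?i ?s4 T' s5 \<and> s5 0 = (if b (s 0) \<noteq> Leaf then f (s 0) else g (s 0)) \<and>
        (\<forall>x\<ge>k. s5 x = ?s4 x) \<and> T' \<le> t (s 0) + t' (s 0) + 1"
    proof (cases "b (s 0) = Leaf")
      case True
      obtain T' s5 where 2: "exec c' ?s4 T' s5" "s5 0 = g (?s4 0)"
        "\<And>x. x \<ge> k \<Longrightarrow> s5 x = ?s4 x" "T' \<le> t' (?s4 0)"
        by (rule computesD[OF c(3), where s = "?s4"]) blast
      have "exec ?i ?s4 (1 + T') s5"
        by (rule exec.IfFalse[OF _ 2(1)]) (use s4 True in simp)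
      with 2 True s4 c(4) show ?thesis by (intro exI[of _ "1 + T'"] exI[of _ s5]) simp
    next
      case False
      obtain T' s5 where 2: "exec c ?s4 T' s5" "s5 0 = f (?s4 0)"
        "\<And>x. x \<ge> k \<Longrightarrow> s5 x = ?s4 x" "T' \<le> t (?s4 0)"
        by (rule computesD[OF c(2), where s = "?s4"]) blast
      have "exec ?i ?s4 (1 + T') s5"
        by (rule exec.IfTrue[OF _ 2(1)]) (use s4 False in simp)
      with 2 False s4 c(4) show ?thesis by (intro exI[of _ "1 + T'"] exI[of _ s5]) simp
    qed
    then obtain T' s5 where 2: "exec ?i ?s4 T' s5"
      "s5 0 = (if b (s 0) \<noteq> Leaf then f (s 0) else g (s 0))"
      "\<And>x. x \<ge> k \<Longrightarrow> s5 x = ?s4 x" "T' \<le> t (s 0) + t' (s 0) + 1" by blast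
    have ex: "exec ?p s (1 + (T + (1 + (1 + T')))) s5"
      by (rule exec.Seq[OF e1 exec.Seq[OF 1(1) exec.Seq[OF e2 exec.Seq[OF e3 2(1)]]]])
    show "\<exists>T s'. exec ?p s T s' \<and> s' 0 = (if b (s 0) \<noteq> Leaf then f (s 0) else g (s 0)) \<and>
        (\<forall>x\<ge>k+2. s' x = s x) \<and> T \<le> tb (s 0) + t (s 0) + t' (s 0) + 4"
      using ex 1 2 s1 by (intro exI[of _ "1 + (T + (1 + (1 + T')))"] exI[of _ s5]) auto
  qed
qed

section \<open>Iteration over lists\<close>

text \<open>Reading every tree as a list makes the list functions total, so that they need not recognise
  encodings.\<close>

fun items :: "data \<Rightarrow> data list" where
  "items Leaf = []"
| "items (Node a b) = a # items b"

lemma length_items: "length (items d) < data_size d"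
  by (induction d) auto

lemma size_items: "a \<in> set (items d) \<Longrightarrow> data_size a < data_size d"
  by (induction d) auto

lemma items_enc_list [simp]: "items (enc_list f xs) = map f xs"
  by (induction xs) auto

text \<open>The step receives the fixed tree \<open>d\<close> besides item and accumulator. Programs
  have no closures, so this is how a step can depend on the whole input.\<close>

definition fold_data :: "(data \<Rightarrow> data) \<Rightarrow> data \<Rightarrow> data list \<Rightarrow> data \<Rightarrow> data" where
  "fold_data st d xs acc = fold (\<lambda>a acc. st (Node d (Node a acc))) xs acc"

lemma fold_data_simps [simp]:
  "fold_data st d [] acc = acc"
  "fold_data st d (a # xs) acc = fold_data st d xs (st (Node d (Node a acc)))"
  by (simp_all add: fold_data_def)

text \<open>Iterating a polynomial-time step may blow up the accumulator, so a polynomial bound on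
  all partial results is assumed. Then each step has an argument of polynomial size, and the list
  bounds the number of steps.\<close>

lemma polytime_fold:
  assumes l: "polytime l" and i: "polytime i" and st: "polytime st"
    and G: "polybounded G"
    and bnd: "\<And>d j. j \<le> length (items (l d)) \<Longrightarrow>
      data_size (fold_data st d (take j (items (l d))) (i d)) \<le> G d"
  shows "polytime (\<lambda>d. fold_data st d (items (l d)) (i d))"
proof -
  obtain cl kl tl where cl: "polybounded tl" "computes cl kl tl l" using l unfolding polytime_def by blast
  obtain ci ki ti where ci: "polybounded ti" "computes ci ki ti i" using i unfolding polytime_def by blast
  obtain cs ks ts where cs: "polybounded ts" "computes cs ks ts st" using st unfolding polytime_def by blast
  obtain C e where C: "\<And>x. ts x \<le> C * data_size x ^ e" using cs(1) unfolding polybounded_def by blast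
  define k where "k = max kl (max ki ks)"
  have c: "computes cl k tl l" "computes ci k ti i" "computes cs k ts st" "k > 0"
    using computes_mono[OF cl(2), of k] computes_mono[OF ci(2), of k] computes_mono[OF cs(2), of k] cl(2)
    by (auto simp: k_def computes_def)
  define body where "body = Seq (Assign 0 (NodeE (Var k) (NodeE (LeftE (Var (k + 1))) (Var 0))))
      (Seq cs (Assign (k + 1) (RightE (Var (k + 1)))))"
  define loop where "loop = While (Var (k + 1)) body"
  \<comment> \<open>Cost of one iteration: \<open>Node d (Node a acc)\<close> has size at most 2
    plus \<open>data_size d\<close>, \<open>data_size (l d)\<close> for the item and
    \<open>G d\<close> for the accumulator; the test and two assignments add 3.\<close>
  define U where "U d = C * (2 + data_size d + data_size (l d) + G d) ^ e + 3" for d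
  have U: "polybounded U"
    unfolding U_def using polytime_size[OF l] G
    by (intro polybounded_add polybounded_mult polybounded_power) auto
  have loop: "\<exists>T s'. exec loop s T s' \<and>
      s' 0 = fold_data st d (items r) (s 0) \<and> (\<forall>x\<ge>k+2. s' x = s x) \<and> s' k = d \<and>
      T \<le> length (items r) * U d + 1"
    if "s k = d" "s (k + 1) = r" "data_size r \<le> data_size (l d)"
      "\<forall>j\<le>length (items r). data_size (fold_data st d (take j (items r)) (s 0)) \<le> G d"
    for s d r
    using that
  proof (induction r arbitrary: s)
    case Leaf
    have "exec loop s 1 s" unfolding loop_def by (rule exec.WhileFalse) (use Leaf in simp)
    then show ?case using Leaf by (intro exI[of _ 1] exI[of _ s]) simp
  next
    case (Node a r)
    let ?s1 = "s(0 := Node d (Node a (s 0)))"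
    have e1: "exec (Assign 0 (NodeE (Var k) (NodeE (LeftE (Var (k + 1))) (Var 0)))) s 1 ?s1"
      using exec.Assign[of 0 "NodeE (Var k) (NodeE (LeftE (Var (k + 1))) (Var 0))" s] Node.prems
      by simp
    obtain T s2 where 1: "exec cs ?s1 T s2" "s2 0 = st (?s1 0)"
      "\<And>x. x \<ge> k \<Longrightarrow> s2 x = ?s1 x" "T \<le> ts (?s1 0)"
      by (rule computesD[OF c(3), where s = "?s1"]) blast
    let ?s3 = "s2(k + 1 := r)"
    have "s2 (k + 1) = Node a r" using 1(3)[of "k+1"] Node.prems c(4) by simp
    then have e2: "exec (Assign (k + 1) (RightE (Var (k + 1)))) s2 1 ?s3"
      using exec.Assign[of "k+1" "RightE (Var (k + 1))" s2] by simp
    have e: "exec body s (1 + (T + 1)) ?s3"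
      unfolding body_def by (rule exec.Seq[OF e1 exec.Seq[OF 1(1) e2]])
    have s3: "?s3 k = d" "?s3 (k + 1) = r" "?s3 0 = st (Node d (Node a (s 0)))"
      using 1 Node.prems c(4) by auto
    have bnd': "\<forall>j\<le>length (items r). data_size (fold_data st d (take j (items r)) (?s3 0)) \<le> G d"
    proof (intro allI impI)
      fix j assume "j \<le> length (items r)"
      then show "data_size (fold_data st d (take j (items r)) (?s3 0)) \<le> G d"
        using Node.prems(4)[rule_format, of "Suc j"] s3(3) by simp
    qed
    have "data_size r \<le> data_size (l d)" using Node.prems(3) by simp
    from Node.IH(2)[OF s3(1,2) this bnd'] obtain T' s' where
      2: "exec loop ?s3 T' s'" "s' 0 = fold_data st d (items r) (?s3 0)"
         "\<forall>x\<ge>k+2. s' x = ?s3 x" "s' k = d" "T' \<le> length (items r) * U d + 1" by blast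
    have ex: "exec loop s (1 + (1 + (T + 1)) + T') s'"
      unfolding loop_def by (rule exec.WhileTrue[OF _ e 2(1)[unfolded loop_def]]) (use Node.prems in simp)
    have "data_size (s 0) \<le> G d" using Node.prems(4)[rule_format, of 0] by simp
    then have "data_size (?s1 0) \<le> 2 + data_size d + data_size (l d) + G d"
      using Node.prems(3) by simp
    then have "T + 3 \<le> U d"
      using 1(4) C[of "?s1 0"] unfolding U_def
      by (meson add_mono le_refl mult_le_mono2 order_trans power_mono zero_le)
    then have "1 + (1 + (T + 1)) + T' \<le> length (items (Node a r)) * U d + 1"
      using 2(5) by simp
    then show ?case using ex 2 s3 1 by (intro exI[of _ "1 + (1 + (T + 1)) + T'"] exI[of _ s']) auto
  qed
  let ?p = "Seq (Assign k (Var 0)) (Seq cl (Seq (Assign (k + 1) (Var 0)) (Seq (Assign 0 (Var k))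
    (Seq ci loop))))"
  show ?thesis
  proof (rule polytimeI[where c = ?p and k = "k + 2"
        and t = "\<lambda>d. tl d + ti d + data_size (l d) * U d + 4"])
    show "polybounded (\<lambda>d. data_size (fold_data st d (items (l d)) (i d)))"
      by (rule polybounded_mono[OF G]) (use bnd[OF order.refl] in simp)
    show "polybounded (\<lambda>d. tl d + ti d + data_size (l d) * U d + 4)"
      by (intro polybounded_add polybounded_mult polybounded_const cl(1) ci(1) U polytime_size[OF l])
    show "0 < k + 2" by simp
    fix s :: store
    let ?s1 = "s(k := s 0)"
    have e1: "exec (Assign k (Var 0)) s 1 ?s1" using exec.Assign[of k "Var 0" s] by simp
    obtain T s2 where 1: "exec cl ?s1 T s2" "s2 0 = l (?s1 0)"
      "\<And>x. x \<ge> k \<Longrightarrow> s2 x = ?s1 x" "T \<le> tl (?s1 0)"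
      by (rule computesD[OF c(1), where s = "?s1"]) blast
    let ?s3 = "s2(k + 1 := s2 0)"
    let ?s4 = "?s3(0 := ?s3 k)"
    have e2: "exec (Assign (k + 1) (Var 0)) s2 1 ?s3" using exec.Assign[of "k+1" "Var 0" s2] by simp
    have e3: "exec (Assign 0 (Var k)) ?s3 1 ?s4" using exec.Assign[of 0 "Var k" ?s3] by simp
    obtain T' s5 where 2: "exec ci ?s4 T' s5" "s5 0 = i (?s4 0)"
      "\<And>x. x \<ge> k \<Longrightarrow> s5 x = ?s4 x" "T' \<le> ti (?s4 0)"
      by (rule computesD[OF c(2), where s = "?s4"]) blast
    have s1: "?s1 0 = s 0" using c(4) by simp
    have s4: "?s4 0 = s 0" using c(4) 1(3)[of k] by simp
    have s5: "s5 k = s 0" "s5 (k + 1) = l (s 0)" "s5 0 = i (s 0)"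
      using 1(2) 1(3)[of k] 2(2) 2(3)[of k] 2(3)[of "k+1"] c(4) s1 s4 by simp_all
    have "\<forall>j\<le>length (items (l (s 0))).
        data_size (fold_data st (s 0) (take j (items (l (s 0)))) (s5 0)) \<le> G (s 0)"
      using bnd s5 by simp
    from loop[OF s5(1,2) order.refl this] obtain T'' s6 where
      3: "exec loop s5 T'' s6" "s6 0 = fold_data st (s 0) (items (l (s 0))) (s5 0)"
         "\<forall>x\<ge>k+2. s6 x = s5 x" "T'' \<le> length (items (l (s 0))) * U (s 0) + 1" by blast
    have ex: "exec ?p s (1 + (T + (1 + (1 + (T' + T''))))) s6"
      by (rule exec.Seq[OF e1 exec.Seq[OF 1(1) exec.Seq[OF e2 exec.Seq[OF e3 exec.Seq[OF 2(1) 3(1)]]]]])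
    have "length (items (l (s 0))) * U (s 0) \<le> data_size (l (s 0)) * U (s 0)"
      using length_items[of "l (s 0)"] by simp
    then have "1 + (T + (1 + (1 + (T' + T'')))) \<le> tl (s 0) + ti (s 0) + data_size (l (s 0)) * U (s 0) + 4"
      using 1(4)[unfolded s1] 2(4)[unfolded s4] 3(4) by linarith
    then show "\<exists>T s'. exec ?p s T s' \<and> s' 0 = fold_data st (s 0) (items (l (s 0))) (i (s 0)) \<and>
        (\<forall>x\<ge>k+2. s' x = s x) \<and> T \<le> tl (s 0) + ti (s 0) + data_size (l (s 0)) * U (s 0) + 4"
      using ex 1 2 3 s5 by (intro exI[of _ "1 + (T + (1 + (1 + (T' + T''))))"] exI[of _ s6]) auto
  qed
qed

text \<open>When the growth of a step depends on \<open>d\<close> and \<open>a\<close> but not on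
  the accumulator, the increments add up instead of compounding, and the bound that
  \<open>polytime_fold\<close> asks for is automatic.\<close>

lemma polytime_fold_additive:
  assumes l: "polytime l" and i: "polytime i" and st: "polytime st" and G: "polybounded G"
    and grow: "\<And>d a acc. data_size (st (Node d (Node a acc))) \<le> data_size acc + G (Node d a)"
  shows "polytime (\<lambda>d. fold_data st d (items (l d)) (i d))"
proof -
  obtain C e where C: "\<And>x. G x \<le> C * data_size x ^ e" using G unfolding polybounded_def by blast
  define U where "U d = C * (1 + data_size d + data_size (l d)) ^ e" for d
  have U: "polybounded U"
    unfolding U_def using polytime_size[OF l]
    by (intro polybounded_add polybounded_mult polybounded_power) auto
  have *: "data_size (fold_data st d xs acc) \<le> data_size acc + length xs * U d"
    if "set xs \<subseteq> set (items (l d))" for d xs acc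
    using that
  proof (induction xs arbitrary: acc)
    case (Cons a xs)
    have "data_size (Node d a) \<le> 1 + data_size d + data_size (l d)"
      using size_items[of a "l d"] Cons.prems by auto
    then have "G (Node d a) \<le> U d"
      using C[of "Node d a"] unfolding U_def
      by (meson mult_le_mono2 order_trans power_mono zero_le)
    then show ?case using Cons.IH[of "st (Node d (Node a acc))"] Cons.prems grow[of d a acc] by simp
  qed simp
  show ?thesis
  proof (rule polytime_fold[OF l i st, of "\<lambda>d. data_size (i d) + data_size (l d) * U d"])
    show "polybounded (\<lambda>d. data_size (i d) + data_size (l d) * U d)"
      using polytime_size[OF l] polytime_size[OF i] U by auto
    fix d j
    assume "j \<le> length (items (l d))"
    have "data_size (fold_data st d (take j (items (l d))) (i d))
        \<le> data_size (i d) + length (take j (items (l d))) * U d"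
      by (rule *) (rule set_take_subset)
    also have "\<dots> \<le> data_size (i d) + data_size (l d) * U d"
      using length_items[of "l d"] by (intro add_left_mono mult_le_mono1) simp
    finally show "data_size (fold_data st d (take j (items (l d))) (i d))
        \<le> data_size (i d) + data_size (l d) * U d" .
  qed
qed

named_theorems polytime_intros

lemma polytime_left' [polytime_intros]: "polytime f \<Longrightarrow> polytime (\<lambda>x. left (f x))"
  by (rule polytime_comp[OF _ polytime_left])

lemma polytime_right' [polytime_intros]: "polytime f \<Longrightarrow> polytime (\<lambda>x. right (f x))"
  by (rule polytime_comp[OF _ polytime_right])

lemmas [polytime_intros] = polytime_id polytime_const polytime_Node

definition cons_step :: "data \<Rightarrow> data" where
  "cons_step z = Node (left (right z)) (right (right z))"

lemma polytime_cons_step: "polytime cons_step"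
  unfolding cons_step_def by (intro polytime_intros)

lemma fold_cons_step:
  "fold_data cons_step d (map f xs) (enc_list f ys) = enc_list f (rev xs @ ys)"
proof (induction xs arbitrary: ys)
  case (Cons x xs)
  then show ?case using Cons.IH[of "x # ys"] by (simp add: cons_step_def)
qed simp

lemma polytime_fold_cons:
  assumes "polytime l" "polytime i"
  shows "polytime (\<lambda>d. fold_data cons_step d (items (l d)) (i d))"
proof (rule polytime_fold_additive[OF assms polytime_cons_step, of "\<lambda>x. 1 + data_size x"])
  fix d a acc
  show "data_size (cons_step (Node d (Node a acc))) \<le> data_size acc + (1 + data_size (Node d a))"
    by (simp add: cons_step_def)
qed (intro polybounded_add polybounded_const polybounded_size)

definition rev_data :: "data \<Rightarrow> data" where
  "rev_data d = fold_data cons_step d (items d) Leaf"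

lemma rev_data_enc [simp]: "rev_data (enc_list f xs) = enc_list f (rev xs)"
  using fold_cons_step[of _ f xs "[]"] by (simp add: rev_data_def)

lemma polytime_rev [polytime_intros]: "polytime f \<Longrightarrow> polytime (\<lambda>x. rev_data (f x))"
  by (rule polytime_comp[of f rev_data])
     (auto simp: rev_data_def[abs_def] intro: polytime_fold_cons polytime_intros)

definition append_data :: "data \<Rightarrow> data" where
  "append_data d = fold_data cons_step d (items (rev_data (left d))) (right d)"

lemma append_data_enc [simp]:
  "append_data (Node (enc_list f xs) (enc_list f ys)) = enc_list f (xs @ ys)"
  using fold_cons_step[of _ f "rev xs" ys] by (simp add: append_data_def)

lemma polytime_append [polytime_intros]: "polytime f \<Longrightarrow> polytime (\<lambda>x. append_data (f x))"
  by (rule polytime_comp[of f append_data])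
     (auto simp: append_data_def[abs_def] intro!: polytime_fold_cons polytime_intros)

lemma data_eq_enc_list: "d = enc_list (\<lambda>x. x) (items d)"
  by (induction d) auto

lemma data_size_enc_list: "data_size (enc_list f xs) = 1 + (\<Sum>x\<leftarrow>xs. 1 + data_size (f x))"
  by (induction xs) auto

lemma data_size_append: "data_size (append_data (Node x y)) \<le> data_size x + data_size y"
proof -
  obtain xs ys where "x = enc_list (\<lambda>x. x) xs" "y = enc_list (\<lambda>x. x) ys"
    using data_eq_enc_list by blast
  then show ?thesis by (simp add: data_size_enc_list)
qed

definition concat_step :: "(data \<Rightarrow> data) \<Rightarrow> data \<Rightarrow> data" where
  "concat_step g z = append_data (Node (g (Node (left z) (left (right z)))) (right (right z)))"

text \<open>Each step prepends its block, so the list is traversed backwards to keep the blocks in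
  order.\<close>

lemma polytime_concat:
  assumes "polytime l" "polytime g"
  shows "polytime (\<lambda>d. fold_data (concat_step g) d (items (rev_data (l d))) Leaf)"
proof (rule polytime_fold_additive[of _ _ _ "\<lambda>x. data_size (g x)"])
  show "polytime (concat_step g)"
    unfolding concat_step_def by (intro polytime_intros polytime_comp[OF _ assms(2)])
  fix d a acc
  show "data_size (concat_step g (Node d (Node a acc))) \<le> data_size acc + data_size (g (Node d a))"
    using data_size_append[of "g (Node d a)" acc] by (simp add: concat_step_def)
qed (intro polytime_intros assms polytime_size)+

text \<open>A unary number is itself a list and can drive the loop. The accumulator is
  \<open>right (right z)\<close>, and the third \<open>right\<close> takes its tail;
  \<open>right Leaf = Leaf\<close> covers dropping too much.\<close>

definition drop_data :: "data \<Rightarrow> data" where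
  "drop_data d = fold_data (\<lambda>z. right (right (right z))) d (items (left d)) (right d)"

lemma drop_data_enc [simp]:
  "drop_data (Node (enc_nat n) (enc_list f xs)) = enc_list f (drop n xs)"
proof -
  have "fold_data (\<lambda>z. right (right (right z))) d (items (enc_nat n)) (enc_list f xs)
      = enc_list f (drop n xs)" for d
  proof (induction n arbitrary: xs)
    case (Suc n)
    then show ?case using Suc.IH[of "[]"] by (cases xs) auto
  qed auto
  then show ?thesis by (simp add: drop_data_def)
qed

lemma polytime_drop [polytime_intros]:
  assumes "polytime f"
  shows "polytime (\<lambda>x. drop_data (f x))"
proof (rule polytime_comp[OF assms, of drop_data])
  show "polytime drop_data"
    unfolding drop_data_def
  proof (rule polytime_fold_additive[of _ _ _ "\<lambda>x. 0"])
    fix d a acc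
    show "data_size (right (right (right (Node d (Node a acc))))) \<le> data_size acc + 0"
      using data_size_right[of acc] by simp
  qed (intro polytime_intros polybounded_const)+
qed

text \<open>The accumulator pairs a counter with the list of smaller numbers in descending
  order.\<close>

definition upt_step :: "data \<Rightarrow> data" where
  "upt_step z = Node (Node Leaf (left (right (right z)))) (right (right z))"

definition upt_data :: "data \<Rightarrow> data" where
  "upt_data d = rev_data (right (fold_data upt_step d (items d) (Node Leaf Leaf)))"

lemma fold_upt_step:
  "fold_data upt_step d xs (Node Leaf Leaf) =
   Node (enc_nat (length xs)) (enc_list enc_nat (rev [0..<length xs]))"
  by (induction xs rule: rev_induct) (simp_all add: fold_data_def upt_step_def)

lemma data_size_enc_nat: "data_size (enc_nat n) = 2 * n + 1"
  by (induction n) auto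

lemma length_items_enc_nat [simp]: "length (items (enc_nat n)) = n"
  by (induction n) auto

lemma upt_data_enc [simp]: "upt_data (enc_nat n) = enc_list enc_nat [0..<n]"
  by (simp add: upt_data_def fold_upt_step)

lemma polytime_upt [polytime_intros]:
  assumes "polytime f"
  shows "polytime (\<lambda>x. upt_data (f x))"
proof (rule polytime_comp[OF assms, of upt_data])
  \<comment> \<open>The growth of a step depends on the counter inside the accumulator, so the
    additive criterion does not apply; the sizes of the unary numbers sum to a quadratic
    bound.\<close>
  have "polytime (\<lambda>d. fold_data upt_step d (items d) (Node Leaf Leaf))"
  proof (rule polytime_fold[of _ _ _ "\<lambda>d. (2 * data_size d + 3) * (data_size d + 1)"])
    show "polytime upt_step" unfolding upt_step_def by (intro polytime_intros)
    show "polybounded (\<lambda>d. (2 * data_size d + 3) * (data_size d + 1))"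
      by (intro polybounded_mult polybounded_add polybounded_const polybounded_size)
    fix d j
    have "(\<Sum>x\<leftarrow>rev [0..<m]. 1 + data_size (enc_nat x)) \<le> (2 * m + 1) * m" for m
    proof (induction m)
      case (Suc m)
      then show ?case by (simp add: data_size_enc_nat)
    qed simp
    note * = this[of j]
    assume "j \<le> length (items d)"
    then have "j \<le> data_size d" using length_items[of d] by simp
    then have "(2 * j + 3) * (j + 1) \<le> (2 * data_size d + 3) * (data_size d + 1)"
      by (intro mult_le_mono) auto
    moreover have "2 + data_size (enc_nat j) + (\<Sum>x\<leftarrow>rev [0..<j]. 1 + data_size (enc_nat x))
        \<le> (2 * j + 3) * (j + 1)"
      using * unfolding data_size_enc_nat by (simp add: algebra_simps)
    ultimately show "data_size (fold_data upt_step d (take j (items d)) (Node Leaf Leaf))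
        \<le> (2 * data_size d + 3) * (data_size d + 1)"
      using \<open>j \<le> length (items d)\<close>
      by (simp add: fold_upt_step data_size_enc_list min_absorb2)
  qed (intro polytime_intros)+
  then show "polytime upt_data"
    unfolding upt_data_def by (intro polytime_intros)
qed

section \<open>Polynomial-time functions between encoded types\<close>

definition ptime :: "('a \<Rightarrow> data) \<Rightarrow> ('b \<Rightarrow> data) \<Rightarrow> ('a \<Rightarrow> 'b) \<Rightarrow> bool" where
  "ptime A B f \<longleftrightarrow> (\<exists>g. polytime g \<and> (\<forall>x. g (A x) = B (f x)))"

lemma ptimeI: "polytime g \<Longrightarrow> (\<And>x. g (A x) = B (f x)) \<Longrightarrow> ptime A B f"
  unfolding ptime_def by blast

lemma ptimeE:
  assumes "ptime A B f"
  obtains g where "polytime g" "\<And>x. g (A x) = B (f x)"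
  using assms unfolding ptime_def by blast

named_theorems ptime_intros

lemma ptime_lift:
  assumes "ptime A B f" "\<And>g. polytime g \<Longrightarrow> polytime (\<lambda>x. h (g x))" "\<And>y. h (B y) = C (f' y)"
  shows "ptime A C (\<lambda>x. f' (f x))"
proof -
  obtain g where g: "polytime g" "\<And>x. g (A x) = B (f x)" using assms(1) by (rule ptimeE) blast
  show ?thesis by (rule ptimeI[of "\<lambda>x. h (g x)"]) (use assms g in auto)
qed

lemma ptime_comp:
  assumes "ptime A B f" "ptime B C g"
  shows "ptime A C (\<lambda>x. g (f x))"
proof -
  obtain h where h: "polytime h" "\<And>x. h (B x) = C (g x)" using assms(2) by (rule ptimeE) blast
  show ?thesis by (rule ptime_lift[OF assms(1), of h]) (use h polytime_comp in auto)
qed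

lemma ptime_id [ptime_intros]: "ptime A A (\<lambda>x. x)"
  by (rule ptimeI[OF polytime_id]) simp

lemma ptime_const [ptime_intros]: "ptime A B (\<lambda>_. c)"
  by (rule ptimeI[OF polytime_const]) simp

lemma enc_pair_eq: "enc_pair A B p = Node (A (fst p)) (B (snd p))"
  by (cases p) simp

lemma ptime_Pair [ptime_intros]:
  assumes "ptime A B f" "ptime A C g"
  shows "ptime A (enc_pair B C) (\<lambda>x. (f x, g x))"
proof -
  obtain f' where f: "polytime f'" "\<And>x. f' (A x) = B (f x)" using assms(1) by (rule ptimeE) blast
  obtain g' where g: "polytime g'" "\<And>x. g' (A x) = C (g x)" using assms(2) by (rule ptimeE) blast
  show ?thesis by (rule ptimeI[OF polytime_Node[OF f(1) g(1)]]) (simp add: f g)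
qed

lemma ptime_fst [ptime_intros]: "ptime A (enc_pair B C) f \<Longrightarrow> ptime A B (\<lambda>x. fst (f x))"
  by (erule ptime_lift[of _ _ _ left]) (auto intro: polytime_intros simp: enc_pair_eq)

lemma ptime_snd [ptime_intros]: "ptime A (enc_pair B C) f \<Longrightarrow> ptime A C (\<lambda>x. snd (f x))"
  by (erule ptime_lift[of _ _ _ right]) (auto intro: polytime_intros simp: enc_pair_eq)

lemma enc_bool_Leaf [simp]: "enc_bool b = Leaf \<longleftrightarrow> \<not> b"
  by (cases b) auto

lemma ptime_If [ptime_intros]:
  assumes "ptime A enc_bool b" "ptime A B f" "ptime A B g"
  shows "ptime A B (\<lambda>x. if b x then f x else g x)"
proof -
  obtain b' where b: "polytime b'" "\<And>x. b' (A x) = enc_bool (b x)"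
    using assms(1) by (rule ptimeE) blast
  obtain f' where f: "polytime f'" "\<And>x. f' (A x) = B (f x)" using assms(2) by (rule ptimeE) blast
  obtain g' where g: "polytime g'" "\<And>x. g' (A x) = B (g x)" using assms(3) by (rule ptimeE) blast
  show ?thesis by (rule ptimeI[OF polytime_If[OF b(1) f(1) g(1)]]) (simp add: b f g)
qed

lemma ptime_Not [ptime_intros]: "ptime A enc_bool b \<Longrightarrow> ptime A enc_bool (\<lambda>x. \<not> b x)"
  by (erule ptime_lift[of _ _ _ "\<lambda>z. if z \<noteq> Leaf then Leaf else Node Leaf Leaf"])
     (auto intro: polytime_If[OF _ polytime_const polytime_const, simplified])

lemma ptime_conj [ptime_intros]:
  "ptime A enc_bool b \<Longrightarrow> ptime A enc_bool c \<Longrightarrow> ptime A enc_bool (\<lambda>x. b x \<and> c x)"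
  using ptime_If[OF _ _ ptime_const, of A b enc_bool c False]
  by (simp add: if_bool_eq_conj conj_commute cong: conj_cong)

lemma ptime_iff [ptime_intros]:
  assumes "ptime A enc_bool b" "ptime A enc_bool c"
  shows "ptime A enc_bool (\<lambda>x. b x = c x)"
proof -
  have "(\<lambda>x. b x = c x) = (\<lambda>x. if b x then c x else \<not> c x)" by auto
  then show ?thesis using ptime_If[OF assms ptime_Not[OF assms(2)]] by simp
qed

lemma enc_list_Leaf [simp]: "enc_list f xs = Leaf \<longleftrightarrow> xs = []"
  by (cases xs) auto

lemma ptime_null [ptime_intros]:
  assumes "ptime A (enc_list B) l"
  shows "ptime A enc_bool (\<lambda>x. l x = [])"
proof (rule ptime_lift[OF assms, of "\<lambda>z. if z \<noteq> Leaf then Leaf else Node Leaf Leaf"])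
  show "polytime (\<lambda>x. if g x \<noteq> Leaf then Leaf else Node Leaf Leaf)" if "polytime g" for g
    using polytime_If[OF that polytime_const polytime_const] .
qed auto

lemma ptime_Cons [ptime_intros]:
  assumes "ptime A B f" "ptime A (enc_list B) g"
  shows "ptime A (enc_list B) (\<lambda>x. f x # g x)"
proof -
  obtain f' where f: "polytime f'" "\<And>x. f' (A x) = B (f x)" using assms(1) by (rule ptimeE) blast
  obtain g' where g: "polytime g'" "\<And>x. g' (A x) = enc_list B (g x)"
    using assms(2) by (rule ptimeE) blast
  show ?thesis by (rule ptimeI[OF polytime_Node[OF f(1) g(1)]]) (simp add: f g)
qed

lemma ptime_append [ptime_intros]:
  assumes "ptime A (enc_list B) f" "ptime A (enc_list B) g"
  shows "ptime A (enc_list B) (\<lambda>x. f x @ g x)"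
proof -
  have "ptime A (enc_list B) (\<lambda>x. fst (f x, g x) @ snd (f x, g x))"
    by (rule ptime_lift[OF ptime_Pair[OF assms], of append_data])
       (auto intro: polytime_intros simp: enc_pair_eq)
  then show ?thesis by simp
qed

lemma ptime_concat_map [ptime_intros]:
  assumes "ptime A (enc_list B) l" "ptime (enc_pair A B) (enc_list C) (\<lambda>p. f (fst p) (snd p))"
  shows "ptime A (enc_list C) (\<lambda>x. concat (map (f x) (l x)))"
proof -
  obtain l' where l: "polytime l'" "\<And>x. l' (A x) = enc_list B (l x)"
    using assms(1) by (rule ptimeE) blast
  obtain f' where f: "polytime f'" "\<And>p. f' (enc_pair A B p) = enc_list C (f (fst p) (snd p))"
    using assms(2) by (rule ptimeE) blast
  have f': "f' (Node (A x) (B b)) = enc_list C (f x b)" for x b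
    using f(2)[of "(x, b)"] by simp
  have "fold_data (concat_step f') (A x) (map B (rev bs)) Leaf = enc_list C (concat (map (f x) bs))"
    for x bs
    by (induction bs) (simp_all add: fold_data_def concat_step_def f')
  then show ?thesis
    by (intro ptimeI[OF polytime_concat[OF l(1) f(1)]]) (simp add: l rev_map)
qed

lemma ptime_map [ptime_intros]:
  assumes "ptime A (enc_list B) l" "ptime (enc_pair A B) C (\<lambda>p. f (fst p) (snd p))"
  shows "ptime A (enc_list C) (\<lambda>x. map (f x) (l x))"
proof -
  have "ptime A (enc_list C) (\<lambda>x. concat (map (\<lambda>b. [f x b]) (l x)))"
    by (rule ptime_concat_map[OF assms(1)]) (intro ptime_intros assms(2))
  then show ?thesis by simp
qed

text \<open>\<open>left Leaf = Leaf\<close> is also the code of \<open>[]\<close>, which fixes the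
  default value of the head and hence the restriction to lists of lists.\<close>

lemma ptime_hd [ptime_intros]:
  assumes "ptime A (enc_list (enc_list B)) l"
  shows "ptime A (enc_list B) (\<lambda>x. case l x of [] \<Rightarrow> [] | c # _ \<Rightarrow> c)"
  by (rule ptime_lift[OF assms, of left]) (auto intro: polytime_intros split: list.split)

lemma ptime_drop [ptime_intros]:
  assumes "ptime A enc_nat n" "ptime A (enc_list B) l"
  shows "ptime A (enc_list B) (\<lambda>x. drop (n x) (l x))"
proof -
  have "ptime A (enc_list B) (\<lambda>x. (\<lambda>p. drop (fst p) (snd p)) (n x, l x))"
    by (rule ptime_lift[OF ptime_Pair[OF assms], of drop_data])
       (auto intro: polytime_intros simp: enc_pair_eq)
  then show ?thesis by simp
qed

lemma enc_nat_eq: "enc_nat n = enc_list (\<lambda>_. Leaf) (replicate n ())"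
  by (induction n) auto

text \<open>Unary numbers have the same code as lists of units, so arithmetic reduces to list
  operations: addition to append, subtraction to \<open>drop\<close>.\<close>

lemma ptime_nat_iff:
  "ptime A enc_nat n \<longleftrightarrow> ptime A (enc_list (\<lambda>_. Leaf)) (\<lambda>x. replicate (n x) ())"
  by (simp add: ptime_def enc_nat_eq)

lemma ptime_length [ptime_intros]:
  assumes "ptime A (enc_list B) l"
  shows "ptime A enc_nat (\<lambda>x. length (l x))"
proof -
  have "ptime A (enc_list (\<lambda>_. Leaf)) (\<lambda>x. map (\<lambda>_. ()) (l x))"
    by (rule ptime_map[OF assms ptime_const])
  then show ?thesis by (simp add: ptime_nat_iff map_replicate_const)
qed

lemma ptime_upt [ptime_intros]: "ptime A enc_nat n \<Longrightarrow> ptime A (enc_list enc_nat) (\<lambda>x. [0..<n x])"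
  by (rule ptime_lift[of _ _ _ upt_data]) (auto intro: polytime_intros)

lemma ptime_add [ptime_intros]:
  assumes "ptime A enc_nat m" "ptime A enc_nat n"
  shows "ptime A enc_nat (\<lambda>x. m x + n x)"
  using ptime_append[OF assms[unfolded ptime_nat_iff]]
  by (simp add: ptime_nat_iff replicate_add)

lemma ptime_Suc [ptime_intros]: "ptime A enc_nat n \<Longrightarrow> ptime A enc_nat (\<lambda>x. Suc (n x))"
  using ptime_add[OF ptime_const[of A enc_nat 1]] by fastforce

lemma ptime_diff [ptime_intros]:
  assumes "ptime A enc_nat m" "ptime A enc_nat n"
  shows "ptime A enc_nat (\<lambda>x. m x - n x)"
  using ptime_drop[OF assms(2) assms(1)[unfolded ptime_nat_iff]] by (simp add: ptime_nat_iff)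

lemma ptime_mult [ptime_intros]:
  assumes "ptime A enc_nat m" "ptime A enc_nat n"
  shows "ptime A enc_nat (\<lambda>x. m x * n x)"
proof -
  have "ptime A (enc_list enc_nat) (\<lambda>x. concat (map (\<lambda>_. [0..<n x]) [0..<m x]))"
    by (rule ptime_concat_map[OF ptime_upt[OF assms(1)]])
       (rule ptime_upt[OF ptime_comp[OF ptime_fst[OF ptime_id] assms(2)]])
  then have "ptime A enc_nat (\<lambda>x. length (concat (map (\<lambda>_. [0..<n x]) [0..<m x])))"
    by (rule ptime_length)
  then show ?thesis by (simp add: length_concat o_def sum_list_triv)
qed

lemma ptime_nat_eq [ptime_intros]:
  assumes "ptime A enc_nat m" "ptime A enc_nat n"
  shows "ptime A enc_bool (\<lambda>x. m x = n x)"
proof -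
  have "ptime A enc_bool (\<lambda>x. [0..<(m x - n x) + (n x - m x)] = [])"
    by (rule ptime_null[OF ptime_upt]) (intro ptime_add ptime_diff assms)
  moreover have "([0..<(m x - n x) + (n x - m x)] = []) = (m x = n x)" for x by auto
  ultimately show ?thesis by (simp only:)
qed

section \<open>Straight-line drawings\<close>

definition pt_of :: "int \<times> int \<Rightarrow> real \<times> real" where
  "pt_of a = (of_int (fst a), of_int (snd a))"

text \<open>Twice the signed area of the triangle abc, over the integers so that signs are settled
  by evaluation. \<open>side\<close> is the same expression at a real third point, where it is
  affine.\<close>

definition orient :: "int \<times> int \<Rightarrow> int \<times> int \<Rightarrow> int \<times> int \<Rightarrow> int" where
  "orient a b c = (fst b - fst a) * (snd c - snd a) - (snd b - snd a) * (fst c - fst a)"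

definition side :: "int \<times> int \<Rightarrow> int \<times> int \<Rightarrow> real \<times> real \<Rightarrow> real" where
  "side a b z = (of_int (fst b) - of_int (fst a)) * (snd z - of_int (snd a))
     - (of_int (snd b) - of_int (snd a)) * (fst z - of_int (fst a))"

lemma side_pt_of: "side a b (pt_of c) = of_int (orient a b c)"
  by (simp add: side_def orient_def pt_of_def)

lemma side_convex: "side a b ((1 - t) *\<^sub>R x + t *\<^sub>R y) = (1 - t) * side a b x + t * side a b y"
  by (simp add: side_def algebra_simps)

lemma in_segmentE:
  assumes "z \<in> closed_segment (a :: real \<times> real) b"
  obtains t where "0 \<le> t" "t \<le> 1" "z = (1 - t) *\<^sub>R a + t *\<^sub>R b"
  using assms by (auto simp: in_segment)

lemma side_on_segment:
  assumes "z \<in> closed_segment (pt_of a) (pt_of b)"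
  shows "side a b z = 0"
proof -
  obtain t where "z = (1 - t) *\<^sub>R pt_of a + t *\<^sub>R pt_of b" using assms by (rule in_segmentE)
  moreover have "side a b (pt_of a) = 0" "side a b (pt_of b) = 0"
    by (simp_all add: side_pt_of orient_def algebra_simps)
  ultimately show ?thesis by (simp add: side_convex)
qed

lemma convex_comb_same_sign:
  fixes x y t :: real
  assumes "0 \<le> t" "t \<le> 1" "x * y > 0"
  shows "(1 - t) * x + t * y \<noteq> 0"
proof (cases "x > 0")
  case True
  then have "y > 0" using assms(3) by (simp add: zero_less_mult_iff)
  then show ?thesis using True assms(1,2)
    by (smt (verit) mult_nonneg_nonneg mult_pos_pos)
next
  case False
  then have "x < 0" "y < 0" using assms(3) by (auto simp: zero_less_mult_iff)
  then show ?thesis using assms(1,2)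
    by (smt (verit) mult_nonneg_nonpos mult_pos_neg)
qed

text \<open>If c and d lie strictly on one side of the line ab, then by convexity so does the whole
  segment cd.\<close>

lemma segments_disjoint:
  assumes "orient a b c * orient a b d > 0"
  shows "closed_segment (pt_of a) (pt_of b) \<inter> closed_segment (pt_of c) (pt_of d) = {}"
proof -
  have "side a b z \<noteq> 0" if z: "z \<in> closed_segment (pt_of c) (pt_of d)" for z
  proof -
    obtain t where t: "0 \<le> t" "t \<le> 1" "z = (1 - t) *\<^sub>R pt_of c + t *\<^sub>R pt_of d"
      using z by (rule in_segmentE)
    have "real_of_int (orient a b c) * real_of_int (orient a b d) > 0"
      using assms by (simp flip: of_int_mult)
    from convex_comb_same_sign[OF t(1,2) this] t(3) show ?thesis
      by (simp add: side_convex side_pt_of)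
  qed
  then show ?thesis using side_on_segment by blast
qed

text \<open>Along ac, the value of \<open>side a b\<close> is t times \<open>orient a b c\<close>,
  which vanishes only at t = 0.\<close>

lemma segments_common_end:
  assumes "orient a b c \<noteq> 0"
  shows "closed_segment (pt_of a) (pt_of b) \<inter> closed_segment (pt_of a) (pt_of c) \<subseteq> {pt_of a}"
proof
  fix z assume z: "z \<in> closed_segment (pt_of a) (pt_of b) \<inter> closed_segment (pt_of a) (pt_of c)"
  then obtain t where t: "z = (1 - t) *\<^sub>R pt_of a + t *\<^sub>R pt_of c" by (auto elim: in_segmentE)
  have "side a b (pt_of a) = 0" by (simp add: side_pt_of orient_def)
  moreover have "side a b z = 0" using z side_on_segment by blast
  ultimately have "t = 0" using assms by (simp add: t side_convex side_pt_of)
  then show "z \<in> {pt_of a}" by (simp add: t)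
qed

text \<open>
  The tile has 20 vertices. Exactly one of the vertices 1 and 2 is taken, and 2 means that the variable
  is true. In the triangle 0, 3, 4, the vertex 0 receives the signal that the clause is still
  unsatisfied, 3 passes it on, and 4 is available only if the literal is true; edges 1-4 and 2-4 are
  added to the wires depending on the literals in the clause. The vertices from 5 to 19 form a planar
  crossover with ports 5 (west), 7 (north), 17 (east), 19 (south); it was found by computer search.
\<close>

definition tile_pos :: "(int \<times> int) list" where
  "tile_pos = [(5,0),(0,8),(1,9),(4,2),(2,3),(4,3),(1,11),(7,1),(6,4),(3,8),(4,7),(10,4),(10,2),(3,10),
     (7,6),(11,7),(8,6),(11,4),(7,9),(11,11),(12,8),(5,12)]"

definition wires :: "(nat \<times> nat) list" where
  "wires = [(0,3),(0,4),(1,2),(2,5),(3,4),(3,7),(5,6),(6,9),(6,13),(7,8),(8,9),(8,10),(9,10),(9,11),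
     (9,13),(10,11),(10,12),(11,12),(11,14),(12,17),(13,14),(13,15),(13,18),(14,15),(14,16),(15,16),
     (15,18),(16,17),(18,19)]"

text \<open>A superset of the edges at any tile: both optional edges at 4 and the edges leaving to
  the right and downwards. One check of this list covers all clauses.\<close>

definition template :: "(nat \<times> nat) list" where
  "template = wires @ [(1,4),(2,4),(17,20),(19,21)]"

text \<open>A sufficient test: edges with a common endpoint must not be collinear, and of two others
  one must lie strictly on one side of the line through the other.\<close>

definition separated :: "nat \<times> nat \<Rightarrow> nat \<times> nat \<Rightarrow> bool" where
  "separated e f \<longleftrightarrow> (let P = (\<lambda>i. tile_pos ! i); a = fst e; b = snd e; c = fst f; d = snd f in
     if a = c then orient (P a) (P b) (P d) \<noteq> 0 else
     if a = d then orient (P a) (P b) (P c) \<noteq> 0 else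
     if b = c then orient (P b) (P a) (P d) \<noteq> 0 else
     if b = d then orient (P b) (P a) (P c) \<noteq> 0 else
     orient (P a) (P b) (P c) * orient (P a) (P b) (P d) > 0 \<or>
     orient (P c) (P d) (P a) * orient (P c) (P d) (P b) > 0)"

lemma template_edges_separated: "\<forall>e\<in>set template. \<forall>f\<in>set template. e \<noteq> f \<longrightarrow> separated e f"
  by code_simp

lemma template_vertices_separated:
  "\<forall>(a, b)\<in>set template. \<forall>v\<in>set [0..<22]. v \<noteq> a \<longrightarrow> v \<noteq> b \<longrightarrow>
     orient (tile_pos ! a) (tile_pos ! b) (tile_pos ! v) \<noteq> 0"
  by code_simp

lemma tile_pos_bounds:
  "\<forall>i\<in>set [0..<20]. 0 \<le> fst (tile_pos ! i) \<and> fst (tile_pos ! i) < 12 \<and>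
     0 \<le> snd (tile_pos ! i) \<and> snd (tile_pos ! i) < 12"
  by code_simp

text \<open>The last two conjuncts say that no edge runs along a side of the square; this puts the
  relative interior of every edge into the open square.\<close>

lemma template_bounds:
  "\<forall>(a, b)\<in>set template. a < 20 \<and> b < 22 \<and> a < b \<and>
     (\<forall>x\<in>set [fst, snd]. 0 \<le> x (tile_pos ! a) \<and> x (tile_pos ! a) \<le> 12 \<and>
       0 \<le> x (tile_pos ! b) \<and> x (tile_pos ! b) \<le> 12 \<and>
       (0 < x (tile_pos ! a) \<or> 0 < x (tile_pos ! b)) \<and>
       (x (tile_pos ! a) < 12 \<or> x (tile_pos ! b) < 12))"
  by code_simp

lemma convex_comb_strict:
  fixes x y t :: real
  assumes "0 < t" "t < 1" "0 \<le> x" "x \<le> 12" "0 \<le> y" "y \<le> 12" "0 < x \<or> 0 < y" "x < 12 \<or> y < 12"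
  shows "0 < (1 - t) * x + t * y \<and> (1 - t) * x + t * y < 12"
proof
  have "0 < (1 - t) * x \<or> 0 < t * y" "0 \<le> (1 - t) * x" "0 \<le> t * y"
    using assms by auto
  then show "0 < (1 - t) * x + t * y" by linarith
  have "0 < (1 - t) * (12 - x) \<or> 0 < t * (12 - y)" "0 \<le> (1 - t) * (12 - x)" "0 \<le> t * (12 - y)"
    using assms by auto
  then have "0 < (1 - t) * (12 - x) + t * (12 - y)" by linarith
  then show "(1 - t) * x + t * y < 12" by (simp add: algebra_simps)
qed

lemma template_segment_box:
  assumes ab: "(a, b) \<in> set template"
    and z: "z \<in> closed_segment (pt_of (tile_pos ! a)) (pt_of (tile_pos ! b))"
  shows "z = pt_of (tile_pos ! a) \<or> z = pt_of (tile_pos ! b) \<or>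
    0 < fst z \<and> fst z < 12 \<and> 0 < snd z \<and> snd z < 12"
    and "0 \<le> fst z \<and> fst z \<le> 12 \<and> 0 \<le> snd z \<and> snd z \<le> 12"
proof -
  obtain t where t: "0 \<le> t" "t \<le> 1" "z = (1 - t) *\<^sub>R pt_of (tile_pos ! a) + t *\<^sub>R pt_of (tile_pos ! b)"
    using z by (rule in_segmentE) blast
  obtain ax ay bx "by" where P: "tile_pos ! a = (ax, ay)" "tile_pos ! b = (bx, by)"
    by (metis surj_pair)
  have ends: "t = 0 \<Longrightarrow> z = pt_of (tile_pos ! a)" "t = 1 \<Longrightarrow> z = pt_of (tile_pos ! b)"
    using t(3) by auto
  have bnds: "0 \<le> ax" "ax \<le> 12" "0 \<le> bx" "bx \<le> 12" "0 < ax \<or> 0 < bx" "ax < 12 \<or> bx < 12"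
    "0 \<le> ay" "ay \<le> 12" "0 \<le> by" "by \<le> 12" "0 < ay \<or> 0 < by" "ay < 12 \<or> by < 12"
    using bspec[OF template_bounds ab] P by auto
  have coords: "fst z = (1 - t) * of_int ax + t * of_int bx" "snd z = (1 - t) * of_int ay + t * of_int by"
    using t(3) P by (simp_all add: pt_of_def)
  have inner: "0 < fst z \<and> fst z < 12 \<and> 0 < snd z \<and> snd z < 12" if "t \<noteq> 0" "t \<noteq> 1"
    unfolding coords
    using convex_comb_strict[of t "of_int ax" "of_int bx"] convex_comb_strict[of t "of_int ay" "of_int by"]
      t(1,2) that bnds
    by auto
  show "z = pt_of (tile_pos ! a) \<or> z = pt_of (tile_pos ! b) \<or>
    0 < fst z \<and> fst z < 12 \<and> 0 < snd z \<and> snd z < 12"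
    using inner ends by blast
  show "0 \<le> fst z \<and> fst z \<le> 12 \<and> 0 \<le> snd z \<and> snd z \<le> 12"
    using inner bnds coords by (cases "t = 0"; cases "t = 1") auto
qed

definition tile_off :: "nat \<Rightarrow> nat \<Rightarrow> real \<times> real" where
  "tile_off j r = (12 * real j, 12 * real r)"

fun cell_pos :: "nat \<times> nat \<times> nat \<Rightarrow> real \<times> real" where
  "cell_pos (j, r, l) = tile_off j r + pt_of (tile_pos ! l)"

text \<open>The template positions 20 and 21 are the ports of the next tile to the right and of the
  next tile below.\<close>

fun port_cell :: "nat \<times> nat \<times> nat \<Rightarrow> nat \<times> nat \<times> nat" where
  "port_cell (j, r, l) = (if l = 20 then (Suc j, r, 1) else if l = 21 then (j, Suc r, 0) else (j, r, l))"

text \<open>Positions 20 and 21 are positions 1 and 0 moved by the period 12 in the first and in the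
  second coordinate.\<close>

lemma cell_pos_port_cell: "cell_pos (port_cell (j, r, l)) = tile_off j r + pt_of (tile_pos ! l)"
  by (simp add: tile_off_def tile_pos_def pt_of_def)

text \<open>Division by 12 with remainder, which is why the vertices of a tile are kept in the
  half-open square.\<close>

lemma tile_coordinate_unique:
  fixes x x' :: int
  assumes "12 * int j + x = 12 * int j' + x'" "0 \<le> x" "x < 12" "0 \<le> x'" "x' < 12"
  shows "j = j' \<and> x = x'"
proof -
  have "(12 * int j + x) div 12 = int j" "(12 * int j' + x') div 12 = int j'"
    using assms by simp_all
  then show ?thesis using assms(1) by simp
qed

lemma inj_on_cell_pos: "inj_on cell_pos {(j, r, l). l < 20}"
proof (rule inj_onI)
  fix c c' :: "nat \<times> nat \<times> nat"
  assume c: "c \<in> {(j, r, l). l < 20}" "c' \<in> {(j, r, l). l < 20}" "cell_pos c = cell_pos c'"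
  obtain j r l j' r' l' where cc: "c = (j, r, l)" "c' = (j', r', l')" by (metis surj_pair)
  have l: "l < 20" "l' < 20" and eq: "cell_pos (j, r, l) = cell_pos (j', r', l')"
    using c by (auto simp: cc)
  have "real_of_int (12 * int j + fst (tile_pos ! l)) = real_of_int (12 * int j' + fst (tile_pos ! l'))"
       "real_of_int (12 * int r + snd (tile_pos ! l)) = real_of_int (12 * int r' + snd (tile_pos ! l'))"
    using arg_cong[OF eq, of fst] arg_cong[OF eq, of snd] by (simp_all add: tile_off_def pt_of_def)
  then have "12 * int j + fst (tile_pos ! l) = 12 * int j' + fst (tile_pos ! l')"
       "12 * int r + snd (tile_pos ! l) = 12 * int r' + snd (tile_pos ! l')"
    by (simp_all only: of_int_eq_iff)
  moreover have "0 \<le> fst (tile_pos ! l) \<and> fst (tile_pos ! l) < 12 \<and> 0 \<le> snd (tile_pos ! l) \<and>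
      snd (tile_pos ! l) < 12" if "l < 20" for l
    using bspec[OF tile_pos_bounds, of l] that by simp
  note bnds = this[OF l(1)] this[OF l(2)]
  ultimately have "j = j' \<and> r = r' \<and> fst (tile_pos ! l) = fst (tile_pos ! l') \<and>
      snd (tile_pos ! l) = snd (tile_pos ! l')"
    using tile_coordinate_unique bnds by blast
  moreover have "distinct tile_pos" by (simp add: tile_pos_def)
  moreover have "length tile_pos = 22" by (simp add: tile_pos_def)
  ultimately show "c = c'"
    using l cc nth_eq_iff_index_eq[of tile_pos l l'] by (simp add: prod_eq_iff)
qed

lemma template_crossing:
  assumes e: "(a, b) \<in> set template" and f: "(c, d) \<in> set template" and ne: "(a, b) \<noteq> (c, d)"
    and z: "z \<in> closed_segment (pt_of (tile_pos ! a)) (pt_of (tile_pos ! b))"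
      "z \<in> closed_segment (pt_of (tile_pos ! c)) (pt_of (tile_pos ! d))"
  shows "\<exists>i. i \<in> {a, b} \<and> i \<in> {c, d} \<and> z = pt_of (tile_pos ! i)"
proof -
  let ?P = "\<lambda>i. tile_pos ! i"
  have sep: "separated (a, b) (c, d)"
    using template_edges_separated e f ne by blast
  consider "a = c" | "a = d" | "b = c" | "b = d" | "a \<noteq> c" "a \<noteq> d" "b \<noteq> c" "b \<noteq> d" by blast
  then show ?thesis
  proof cases
    case 1
    then have "orient (?P a) (?P b) (?P d) \<noteq> 0" using sep by (simp add: separated_def Let_def)
    from segments_common_end[OF this] z 1 show ?thesis by auto
  next
    case 2
    then have "c \<noteq> a" using bspec[OF template_bounds f] bspec[OF template_bounds e] by auto
    then have "orient (?P a) (?P b) (?P c) \<noteq> 0" using sep 2 by (auto simp: separated_def Let_def)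
    from segments_common_end[OF this] z 2 show ?thesis by (auto simp: closed_segment_commute)
  next
    case 3
    then have "a \<noteq> c" "a \<noteq> d" using bspec[OF template_bounds f] bspec[OF template_bounds e] by auto
    then have "orient (?P b) (?P a) (?P d) \<noteq> 0" using sep 3 by (auto simp: separated_def Let_def)
    from segments_common_end[OF this] z 3 show ?thesis by (auto simp: closed_segment_commute)
  next
    case 4
    then have "a \<noteq> c" "a \<noteq> d" "b \<noteq> c"
      using ne bspec[OF template_bounds f] bspec[OF template_bounds e] by auto
    then have "orient (?P b) (?P a) (?P c) \<noteq> 0" using sep 4 by (auto simp: separated_def Let_def)
    from segments_common_end[OF this] z 4 show ?thesis by (auto simp: closed_segment_commute)
  next
    case 5
    then have "orient (?P a) (?P b) (?P c) * orient (?P a) (?P b) (?P d) > 0 \<or>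
       orient (?P c) (?P d) (?P a) * orient (?P c) (?P d) (?P b) > 0"
      using sep by (simp add: separated_def Let_def)
    then show ?thesis using segments_disjoint z by blast
  qed
qed

lemma template_vertex_on_segment:
  assumes e: "(a, b) \<in> set template" and i: "i < 22"
    and z: "pt_of (tile_pos ! i) \<in> closed_segment (pt_of (tile_pos ! a)) (pt_of (tile_pos ! b))"
  shows "i = a \<or> i = b"
proof (rule ccontr)
  assume "\<not> (i = a \<or> i = b)"
  then have "orient (tile_pos ! a) (tile_pos ! b) (tile_pos ! i) \<noteq> 0"
    using bspec[OF template_vertices_separated e] i by auto
  with side_on_segment[OF z] show False by (simp add: side_pt_of)
qed

lemma straight_line_planar:
  fixes p :: "'a \<Rightarrow> real \<times> real"
  assumes inj: "inj_on p V"
    and E: "\<And>e. e \<in> E \<Longrightarrow> \<exists>u\<in>V. \<exists>v\<in>V. u \<noteq> v \<and> e = {u, v}"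
    and on_edge: "\<And>u v w. {u, v} \<in> E \<Longrightarrow> w \<in> V \<Longrightarrow> p w \<in> closed_segment (p u) (p v) \<Longrightarrow> w = u \<or> w = v"
    and cross: "\<And>u v x y z. {u, v} \<in> E \<Longrightarrow> {x, y} \<in> E \<Longrightarrow> {u, v} \<noteq> {x, y} \<Longrightarrow>
      z \<in> closed_segment (p u) (p v) \<Longrightarrow> z \<in> closed_segment (p x) (p y) \<Longrightarrow> z \<in> p ` ({u, v} \<inter> {x, y})"
  shows "planar V E"
proof -
  obtain f g where fg: "\<And>e. e \<in> E \<Longrightarrow> f e \<in> V \<and> g e \<in> V \<and> f e \<noteq> g e \<and> e = {f e, g e}"
    using E by metis
  define \<gamma> where "\<gamma> e = linepath (p (f e)) (p (g e))" for e
  have "plane_drawing V E p \<gamma>"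
    unfolding plane_drawing_def
  proof (intro conjI ballI impI)
    show "inj_on p V" by (rule inj)
    fix e assume e: "e \<in> E"
    have "p (f e) \<noteq> p (g e)" using fg[OF e] inj by (auto dest: inj_onD)
    then show "arc (\<gamma> e)" unfolding \<gamma>_def by (rule arc_linepath)
    have "p ` e = {p (f e), p (g e)}" using fg[OF e] by (metis image_empty image_insert)
    then show "{pathstart (\<gamma> e), pathfinish (\<gamma> e)} = p ` e" by (simp add: \<gamma>_def)
    have "path_image (\<gamma> e) \<inter> p ` V \<subseteq> p ` e"
    proof
      fix z assume "z \<in> path_image (\<gamma> e) \<inter> p ` V"
      then obtain w where "w \<in> V" "z = p w" "p w \<in> closed_segment (p (f e)) (p (g e))"
        by (auto simp: \<gamma>_def)
      moreover have "{f e, g e} \<in> E" using fg[OF e] e by simp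
      ultimately have "w = f e \<or> w = g e" using on_edge by blast
      then have "w \<in> e" using fg[OF e] by blast
      then show "z \<in> p ` e" using \<open>z = p w\<close> by blast
    qed
    moreover have "p ` e \<subseteq> path_image (\<gamma> e) \<inter> p ` V"
      using fg[OF e] \<open>p ` e = {p (f e), p (g e)}\<close> by (auto simp: \<gamma>_def)
    ultimately show "path_image (\<gamma> e) \<inter> p ` V = p ` e" by blast
  next
    fix e e' assume e: "e \<in> E" "e' \<in> E" "e \<noteq> e'"
    show "path_image (\<gamma> e) \<inter> path_image (\<gamma> e') \<subseteq> p ` (e \<inter> e')"
    proof
      fix z assume "z \<in> path_image (\<gamma> e) \<inter> path_image (\<gamma> e')"
      then have "z \<in> closed_segment (p (f e)) (p (g e))" "z \<in> closed_segment (p (f e')) (p (g e'))"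
        by (auto simp: \<gamma>_def)
      moreover have "{f e, g e} = e" "{f e', g e'} = e'" using fg e by blast+
      ultimately show "z \<in> p ` (e \<inter> e')" using cross[of "f e" "g e" "f e'" "g e'" z] e by simp
    qed
  qed
  then show ?thesis unfolding planar_def by blast
qed

text \<open>Edges of the same tile are translates of template edges, for which crossings are
  excluded by evaluation. Squares of different tiles share only boundary points, and there an edge
  has at most its endpoints.\<close>

lemma tile_graph_planar:
  assumes inj: "inj_on cell V" and V: "\<And>v. v \<in> V \<Longrightarrow> snd (snd (cell v)) < 20"
    and E: "\<And>e. e \<in> E \<Longrightarrow> \<exists>u\<in>V. \<exists>v\<in>V. \<exists>j r a b. e = {u, v} \<and> (a, b) \<in> set template \<and>
      cell u = (j, r, a) \<and> cell v = port_cell (j, r, b)"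
  shows "planar V E"
proof -
  define p where "p = cell_pos \<circ> cell"
  have "inj_on p V"
    unfolding p_def
  proof (rule comp_inj_on[OF inj inj_on_subset[OF inj_on_cell_pos]])
    show "cell ` V \<subseteq> {(j, r, l). l < 20}"
      unfolding case_prod_beta using V by blast
  qed
  then have pinj: "u = v" if "p u = p v" "u \<in> V" "v \<in> V" for u v
    using that by (auto dest: inj_onD)
  have edge: "\<exists>j r a b u' v'. u' \<in> V \<and> v' \<in> V \<and> {u, v} = {u', v'} \<and> (a, b) \<in> set template \<and>
      cell u' = (j, r, a) \<and> cell v' = port_cell (j, r, b) \<and>
      p u' = tile_off j r + pt_of (tile_pos ! a) \<and> p v' = tile_off j r + pt_of (tile_pos ! b) \<and>
      closed_segment (p u) (p v) = closed_segment (p u') (p v')" if uv: "{u, v} \<in> E" for u v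
  proof -
    obtain u' v' j r a b where *: "u' \<in> V" "v' \<in> V" "{u, v} = {u', v'}" "(a, b) \<in> set template"
      "cell u' = (j, r, a)" "cell v' = port_cell (j, r, b)"
      using E[OF uv] by metis
    have "closed_segment (p u) (p v) = closed_segment (p u') (p v')"
      using *(3) by (auto simp: doubleton_eq_iff closed_segment_commute)
    moreover have "p u' = tile_off j r + pt_of (tile_pos ! a)" using *(5) by (simp add: p_def)
    moreover have "p v' = tile_off j r + pt_of (tile_pos ! b)"
      using *(6) cell_pos_port_cell by (simp add: p_def)
    ultimately show ?thesis using * by blast
  qed
  have shift: "z - c \<in> closed_segment a b" if "z \<in> closed_segment (c + a) (c + b)"
    for z c a b :: "real \<times> real"
    using that by (auto simp: closed_segment_translation)
  show ?thesis
  proof (rule straight_line_planar)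
    show "inj_on p V" by fact
    fix e assume "e \<in> E"
    then obtain u v j r a b where *: "u \<in> V" "v \<in> V" "e = {u, v}" "(a, b) \<in> set template"
      "cell u = (j, r, a)" "cell v = port_cell (j, r, b)"
      using E by metis
    have "a < b" using bspec[OF template_bounds *(4)] by simp
    then have "u \<noteq> v" using *(5,6) by (auto split: if_splits)
    with * show "\<exists>u\<in>V. \<exists>v\<in>V. u \<noteq> v \<and> e = {u, v}" by blast
  next
    fix u v w assume uv: "{u, v} \<in> E" and w: "w \<in> V" and on: "p w \<in> closed_segment (p u) (p v)"
    obtain j r a b u' v' where *: "u' \<in> V" "v' \<in> V" "{u, v} = {u', v'}" "(a, b) \<in> set template"
      "cell u' = (j, r, a)" "cell v' = port_cell (j, r, b)"
      "p u' = tile_off j r + pt_of (tile_pos ! a)" "p v' = tile_off j r + pt_of (tile_pos ! b)"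
      "closed_segment (p u) (p v) = closed_segment (p u') (p v')"
      using edge[OF uv] by blast
    obtain j' r' i where cw: "cell w = (j', r', i)" by (metis surj_pair)
    have i: "i < 20" using V[OF w] cw by simp
    have pw: "p w = tile_off j' r' + pt_of (tile_pos ! i)" using cw by (simp add: p_def)
    have z: "p w - tile_off j r \<in> closed_segment (pt_of (tile_pos ! a)) (pt_of (tile_pos ! b))"
      using on *(7-9) shift by simp
    have "w = u' \<or> w = v'"
    proof (cases "p w = p u' \<or> p w = p v'")
      case True
      then show ?thesis using pinj w * by blast
    next
      case False
      then have "p w - tile_off j r \<noteq> pt_of (tile_pos ! a)" "p w - tile_off j r \<noteq> pt_of (tile_pos ! b)"
        using *(7,8) by (auto simp: algebra_simps)
      then have box: "0 < fst (p w - tile_off j r)" "fst (p w - tile_off j r) < 12"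
        "0 < snd (p w - tile_off j r)" "snd (p w - tile_off j r) < 12"
        using template_segment_box(1)[OF *(4) z] by auto
      have "0 \<le> fst (tile_pos ! i)" "fst (tile_pos ! i) < 12" "0 \<le> snd (tile_pos ! i)" "snd (tile_pos ! i) < 12"
        using bspec[OF tile_pos_bounds, of i] i by auto
      then have "0 \<le> fst (pt_of (tile_pos ! i))" "fst (pt_of (tile_pos ! i)) < 12"
        "0 \<le> snd (pt_of (tile_pos ! i))" "snd (pt_of (tile_pos ! i)) < 12"
        by (simp_all add: pt_of_def)
      \<comment> \<open>A vertex strictly inside the square of a tile belongs to that tile, since
        its own offset lies in the half-open square.\<close>
      then have "j' = j" "r' = r" using box pw by (auto simp: tile_off_def)
      then have "pt_of (tile_pos ! i) \<in> closed_segment (pt_of (tile_pos ! a)) (pt_of (tile_pos ! b))"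
        using z pw by simp
      then have "i = a \<or> i = b" using template_vertex_on_segment[OF *(4)] i by simp
      then show ?thesis using False pw \<open>j' = j\<close> \<open>r' = r\<close> *(7,8) by auto
    qed
    then show "w = u \<or> w = v" using *(3) by (auto simp: doubleton_eq_iff)
  next
    fix u v x y z
    assume uv: "{u, v} \<in> E" and xy: "{x, y} \<in> E" and ne: "{u, v} \<noteq> {x, y}"
      and z: "z \<in> closed_segment (p u) (p v)" "z \<in> closed_segment (p x) (p y)"
    obtain j r a b u' v' where e: "u' \<in> V" "v' \<in> V" "{u, v} = {u', v'}" "(a, b) \<in> set template"
      "cell u' = (j, r, a)" "cell v' = port_cell (j, r, b)"
      "p u' = tile_off j r + pt_of (tile_pos ! a)" "p v' = tile_off j r + pt_of (tile_pos ! b)"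
      "closed_segment (p u) (p v) = closed_segment (p u') (p v')"
      using edge[OF uv] by blast
    obtain j' r' c d x' y' where f: "x' \<in> V" "y' \<in> V" "{x, y} = {x', y'}" "(c, d) \<in> set template"
      "cell x' = (j', r', c)" "cell y' = port_cell (j', r', d)"
      "p x' = tile_off j' r' + pt_of (tile_pos ! c)" "p y' = tile_off j' r' + pt_of (tile_pos ! d)"
      "closed_segment (p x) (p y) = closed_segment (p x') (p y')"
      using edge[OF xy] by blast
    have z1: "z - tile_off j r \<in> closed_segment (pt_of (tile_pos ! a)) (pt_of (tile_pos ! b))"
      using z(1) e(7-9) shift by simp
    have z2: "z - tile_off j' r' \<in> closed_segment (pt_of (tile_pos ! c)) (pt_of (tile_pos ! d))"
      using z(2) f(7-9) shift by simp
    have "z \<in> p ` ({u', v'} \<inter> {x', y'})"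
    proof (cases "(z = p u' \<or> z = p v') \<and> (z = p x' \<or> z = p y')")
      case True
      then show ?thesis using pinj e(1,2) f(1,2) by (auto intro!: imageI)
    next
      case False
      \<comment> \<open>One of the two edges has z in its relative interior, hence in its open
        square, which meets no other closed square of the grid.\<close>
      have same: "j = j' \<and> r = r'"
      proof -
        have "0 \<le> fst (z - tile_off j r)" "fst (z - tile_off j r) \<le> 12"
          "0 \<le> snd (z - tile_off j r)" "snd (z - tile_off j r) \<le> 12"
          "0 \<le> fst (z - tile_off j' r')" "fst (z - tile_off j' r') \<le> 12"
          "0 \<le> snd (z - tile_off j' r')" "snd (z - tile_off j' r') \<le> 12"
          using template_segment_box(2)[OF e(4) z1] template_segment_box(2)[OF f(4) z2] by auto
        moreover from False consider
          "z - tile_off j r \<noteq> pt_of (tile_pos ! a)" "z - tile_off j r \<noteq> pt_of (tile_pos ! b)" |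
          "z - tile_off j' r' \<noteq> pt_of (tile_pos ! c)" "z - tile_off j' r' \<noteq> pt_of (tile_pos ! d)"
          using e(7,8) f(7,8) by (auto simp: algebra_simps)
        then have "0 < fst (z - tile_off j r) \<and> fst (z - tile_off j r) < 12 \<and>
            0 < snd (z - tile_off j r) \<and> snd (z - tile_off j r) < 12 \<or>
            0 < fst (z - tile_off j' r') \<and> fst (z - tile_off j' r') < 12 \<and>
            0 < snd (z - tile_off j' r') \<and> snd (z - tile_off j' r') < 12"
          using template_segment_box(1)[OF e(4) z1] template_segment_box(1)[OF f(4) z2] by cases blast+
        ultimately show ?thesis by (auto simp: tile_off_def)
      qed
      have "(a, b) \<noteq> (c, d)"
      proof
        assume "(a, b) = (c, d)"
        then have "p u' = p x'" "p v' = p y'" using same e(7,8) f(7,8) by simp_all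
        then have "{u', v'} = {x', y'}" using pinj e(1,2) f(1,2) by blast
        then show False using ne e(3) f(3) by simp
      qed
      from template_crossing[OF e(4) f(4) this z1] z2 same
      obtain i where i: "i \<in> {a, b}" "i \<in> {c, d}" "z - tile_off j r = pt_of (tile_pos ! i)"
        by auto
      then have "(z = p u' \<or> z = p v') \<and> (z = p x' \<or> z = p y')"
        using same e(7,8) f(7,8) by (auto simp: algebra_simps)
      with False show ?thesis by blast
    qed
    then show "z \<in> p ` ({u, v} \<inter> {x, y})" using e(3) f(3) by simp
  qed
qed

section \<open>The tile as a gadget\<close>

text \<open>Adding the five constraints bounds twice the sum by 5, and the sum is an integer: a
  5-cycle has independence number 2.\<close>

lemma five_cycle:
  fixes d e f j h :: nat
  shows "d + e \<le> 1 \<Longrightarrow> e + f \<le> 1 \<Longrightarrow> f + j \<le> 1 \<Longrightarrow> j + h \<le> 1 \<Longrightarrow> h + d \<le> 1 \<Longrightarrow> d + e + f + j + h \<le> 2"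
  by linarith

text \<open>The letters b to j stand for the tile vertices 9, 10, 11, 12, 17, 13, 14, 15, 16. That a
  choice of size 3 meets {9, 13, 17} will settle the west and east ports, that it meets {9, 10, 13,
  15} the north and south ports.\<close>

lemma crossing_core_bound:
  fixes b c d e f g h i j :: bool
  assumes "\<not> (b \<and> c)" "\<not> (b \<and> d)" "\<not> (c \<and> d)" "\<not> (c \<and> e)" "\<not> (d \<and> e)" "\<not> (e \<and> f)" "\<not> (b \<and> g)"
    "\<not> (d \<and> h)" "\<not> (g \<and> h)" "\<not> (g \<and> i)" "\<not> (h \<and> j)" "\<not> (h \<and> i)" "\<not> (i \<and> j)" "\<not> (j \<and> f)"
  defines "s \<equiv> of_bool b + of_bool c + of_bool d + of_bool e + of_bool f + of_bool g + of_bool h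
    + of_bool i + (of_bool j :: nat)"
  shows "s \<le> 3 \<and> (s = 3 \<longrightarrow> b \<or> g \<or> f) \<and> (s = 3 \<longrightarrow> b \<or> c \<or> g \<or> i)"
proof -
  let ?o = "of_bool :: bool \<Rightarrow> nat"
  have t: "?o b + ?o c + ?o d \<le> 1" "?o c + ?o d + ?o e \<le> 1" "?o g + ?o h + ?o i \<le> 1"
    "?o h + ?o i + ?o j \<le> 1" "?o e + ?o f \<le> 1" "?o j + ?o f \<le> 1" "?o b + ?o g \<le> 1"
    "?o d + ?o h \<le> 1"
    using assms(1-14) by (simp_all add: of_bool_def)
  have "s \<le> 3"
  \<comment> \<open>Either e, f, j contribute at most 1 besides the triangles bcd and ghi, or e and
    j are chosen, which excludes c, d, f, h, i and leaves the edge bg.\<close>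
  proof (cases "f \<or> \<not> (e \<and> j)")
    case True
    then have "?o e + ?o f + ?o j \<le> 1" using assms(6,14) by (auto simp: of_bool_def)
    then show ?thesis using t(1,3) unfolding s_def by linarith
  next
    case False
    then have "?o c + ?o d = 0" "?o h + ?o i = 0" "?o e = 1" "?o f = 0" "?o j = 1"
      using t(2,4) by auto
    then show ?thesis using t(7) unfolding s_def by linarith
  qed
  \<comment> \<open>What remains is covered by the triangles cde and hij.\<close>
  moreover have "s \<noteq> 3" if "\<not> (b \<or> g \<or> f)"
  proof -
    have "?o b = 0" "?o g = 0" "?o f = 0" using that by simp_all
    then show ?thesis using t(2,4) unfolding s_def by linarith
  qed
  \<comment> \<open>What remains is the 5-cycle d, e, f, j, h.\<close>
  moreover have "s \<noteq> 3" if "\<not> (b \<or> c \<or> g \<or> i)"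
  proof -
    have "?o b = 0" "?o c = 0" "?o g = 0" "?o i = 0" using that by simp_all
    then have "s = ?o d + ?o e + ?o f + ?o j + ?o h" unfolding s_def by simp
    then show ?thesis using five_cycle[of "?o d" "?o e" "?o f" "?o j" "?o h"] t(2,4,5,6,8) by linarith
  qed
  ultimately show ?thesis by blast
qed

lemma sum_lessThan_20:
  fixes f :: "nat \<Rightarrow> nat"
  shows "(\<Sum>k<20. f k) = f 0 + f 1 + f 2 + f 3 + f 4 + f 5 + f 6 + f 7 + f 8 + f 9 + f 10 + f 11 + f 12
     + f 13 + f 14 + f 15 + f 16 + f 17 + f 18 + f 19"
  by (simp add: eval_nat_numeral)

definition tile_indep :: "(nat \<Rightarrow> bool) \<Rightarrow> bool" where
  "tile_indep a \<longleftrightarrow> (\<forall>(u, v)\<in>set wires. \<not> (a u \<and> a v))"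

text \<open>The bound 8 adds up 1 for each of five cliques and 3 for the core of the crossover. Attaining it
  makes all six bounds tight, and this forces one of each two opposite ports of the crossover.\<close>

lemma tile_bound:
  assumes "tile_indep a"
  defines "s \<equiv> (\<Sum>k<20. of_bool (a k) :: nat)"
  shows "s \<le> 8"
    and "s = 8 \<Longrightarrow> (a 1 \<or> a 2) \<and> (a 0 \<or> a 3 \<or> a 4) \<and> (a 5 \<or> a 17) \<and> (a 7 \<or> a 19)"
proof -
  have w: "\<not> (a u \<and> a v)" if "(u, v) \<in> set wires" for u v
    using assms(1) that unfolding tile_indep_def by blast
  let ?o = "\<lambda>k. of_bool (a k) :: nat"
  let ?c = "?o 9 + ?o 10 + ?o 11 + ?o 12 + ?o 17 + ?o 13 + ?o 14 + ?o 15 + ?o 16"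
  have core: "?c \<le> 3 \<and> (?c = 3 \<longrightarrow> a 9 \<or> a 13 \<or> a 17) \<and> (?c = 3 \<longrightarrow> a 9 \<or> a 10 \<or> a 13 \<or> a 15)"
    by (rule crossing_core_bound; rule w; simp add: wires_def)
  have s: "s = (?o 1 + ?o 2) + (?o 0 + ?o 3 + ?o 4) + (?o 5 + ?o 6) + (?o 7 + ?o 8) + (?o 18 + ?o 19) + ?c"
    unfolding s_def sum_lessThan_20 by simp
  have p: "?o 1 + ?o 2 \<le> 1" "?o 0 + ?o 3 + ?o 4 \<le> 1" "?o 5 + ?o 6 \<le> 1" "?o 7 + ?o 8 \<le> 1" "?o 18 + ?o 19 \<le> 1"
    using w[of 1 2] w[of 0 3] w[of 0 4] w[of 3 4] w[of 5 6] w[of 7 8] w[of 18 19]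
    by (auto simp: wires_def of_bool_def)
  show "s \<le> 8" using s p core by linarith
  assume "s = 8"
  then have t: "?o 1 + ?o 2 = 1" "?o 0 + ?o 3 + ?o 4 = 1" "?o 5 + ?o 6 = 1" "?o 7 + ?o 8 = 1"
    "?o 18 + ?o 19 = 1" "?c = 3"
    using s p core by linarith+
  have "a 1 \<or> a 2" using t(1) by (cases "a 1"; cases "a 2") auto
  moreover have "a 0 \<or> a 3 \<or> a 4" using t(2) by (cases "a 0"; cases "a 3"; cases "a 4") auto
  moreover have "a 5 \<or> a 6" using t(3) by (cases "a 5"; cases "a 6") auto
  moreover have "a 7 \<or> a 8" using t(4) by (cases "a 7"; cases "a 8") auto
  moreover have "a 18 \<or> a 19" using t(5) by (cases "a 18"; cases "a 19") auto
  moreover have "a 9 \<or> a 13 \<or> a 17" "a 9 \<or> a 10 \<or> a 13 \<or> a 15" using core t(6) by blast+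
  \<comment> \<open>Choosing 9 or 13 excludes 6 and so forces 5; otherwise 17 is chosen. Likewise 9
    or 10 excludes 8 and forces 7, while 13 or 15 excludes 18 and forces 19.\<close>
  ultimately show "(a 1 \<or> a 2) \<and> (a 0 \<or> a 3 \<or> a 4) \<and> (a 5 \<or> a 17) \<and> (a 7 \<or> a 19)"
    using w[of 6 9] w[of 6 13] w[of 8 9] w[of 8 10] w[of 13 18] w[of 15 18]
    by (simp add: wires_def) blast
qed

text \<open>A tile state is given by the value of the variable and by which of the vertices 0, 3, 4 is
  chosen: 3 while the clause is not yet satisfied, 4 where it becomes satisfied, 0 afterwards.\<close>

definition tile_state :: "bool \<Rightarrow> nat \<Rightarrow> nat set" where
  "tile_state x k = insert k (if k = 3
     then if x then {2, 6, 8, 11, 15, 17, 19} else {1, 5, 8, 12, 13, 16, 19}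
     else if x then {2, 6, 7, 10, 14, 17, 18} else {1, 5, 7, 9, 12, 16, 18})"

text \<open>There are only six states, so evaluation suffices. The membership facts are all that
  neighbouring tiles and the optional edges see of a state.\<close>

lemma tile_state_aux:
  "\<forall>k\<in>set [0, 3, 4]. \<forall>x\<in>set [True, False]. let A = tile_state x k in
     (\<forall>(u, v)\<in>set wires. \<not> (u \<in> A \<and> v \<in> A)) \<and> card A = 8 \<and> (\<forall>l\<in>A. l < 20) \<and>
     (1 \<in> A \<longleftrightarrow> \<not> x) \<and> (2 \<in> A \<longleftrightarrow> x) \<and> (17 \<in> A \<longleftrightarrow> x) \<and>
     (0 \<in> A \<longleftrightarrow> k = 0) \<and> (4 \<in> A \<longleftrightarrow> k = 4) \<and> (19 \<in> A \<longleftrightarrow> k = 3)"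
  by code_simp

lemma tile_state:
  assumes "k \<in> {0, 3, 4}"
  shows "tile_indep (\<lambda>l. l \<in> tile_state x k)" "card (tile_state x k) = 8" "tile_state x k \<subseteq> {..<20}"
    "1 \<in> tile_state x k \<longleftrightarrow> \<not> x" "2 \<in> tile_state x k \<longleftrightarrow> x" "17 \<in> tile_state x k \<longleftrightarrow> x"
    "0 \<in> tile_state x k \<longleftrightarrow> k = 0" "4 \<in> tile_state x k \<longleftrightarrow> k = 4" "19 \<in> tile_state x k \<longleftrightarrow> k = 3"
proof -
  have "k \<in> set [0, 3, 4]" "x \<in> set [True, False]" using assms by auto
  note * = tile_state_aux[rule_format, OF this, unfolded Let_def]
  show "tile_indep (\<lambda>l. l \<in> tile_state x k)" "card (tile_state x k) = 8" "tile_state x k \<subseteq> {..<20}"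
    "1 \<in> tile_state x k \<longleftrightarrow> \<not> x" "2 \<in> tile_state x k \<longleftrightarrow> x" "17 \<in> tile_state x k \<longleftrightarrow> x"
    "0 \<in> tile_state x k \<longleftrightarrow> k = 0" "4 \<in> tile_state x k \<longleftrightarrow> k = 4" "19 \<in> tile_state x k \<longleftrightarrow> k = 3"
    using * unfolding tile_indep_def by blast+
qed

section \<open>The graph of a formula\<close>

text \<open>
  The vertex \<open>l\<close> of the cell in column \<open>j\<close> and row \<open>r\<close>. Rows \<open>1, \<dots>, n\<close> hold the tiles of the variables
  \<open>0, \<dots>, n - 1\<close>. Row 0 has only vertex 19 and row \<open>n + 1\<close> only vertex 0, hence the shift by 19: these two
  vertices must be taken and thus start a column with the signal and forbid it at the end.
\<close>

definition vid :: "nat \<Rightarrow> nat \<Rightarrow> nat \<Rightarrow> nat \<Rightarrow> nat" where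
  "vid n j r l = j * (20 * n + 2) + (20 * r + l - 19)"

definition cell_of :: "nat \<Rightarrow> nat \<Rightarrow> nat \<times> nat \<times> nat" where
  "cell_of n v = (v div (20 * n + 2), (v mod (20 * n + 2) + 19) div 20, (v mod (20 * n + 2) + 19) mod 20)"

lemma cell_of_vid:
  assumes "l < 20" "19 \<le> 20 * r + l" "20 * r + l \<le> 20 * n + 20"
  shows "cell_of n (vid n j r l) = (j, r, l)"
proof -
  have less: "20 * r + l - 19 < 20 * n + 2" using assms by linarith
  have "(j * q + w) div q = j \<and> (j * q + w) mod q = w" if "w < q" for q w using that by simp
  from this[OF less] have "vid n j r l div (20 * n + 2) = j" "vid n j r l mod (20 * n + 2) = 20 * r + l - 19"
    unfolding vid_def by blast+
  moreover have "20 * r + l - 19 + 19 = 20 * r + l" using assms by simp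
  ultimately show ?thesis using assms(1) by (simp add: cell_of_def)
qed

lemma vid_cell_of:
  assumes "cell_of n v = (j, r, l)"
  shows "vid n j r l = v"
proof -
  define q where "q = 20 * n + 2"
  have "j = v div q" "20 * r + l = v mod q + 19"
    using assms unfolding cell_of_def q_def[symmetric] by auto
  then show ?thesis unfolding vid_def q_def[symmetric] by simp
qed

lemma inj_cell_of: "inj (cell_of n)"
  by (rule injI) (metis prod_cases3 vid_cell_of)

text \<open>Vertex 1 stands for false, so edge 1-4 keeps a false variable from satisfying the clause
  and is omitted when the negative literal occurs; 2-4 does the same for true.\<close>

definition tile_wires :: "clause \<Rightarrow> nat \<Rightarrow> (nat \<times> nat) list" where
  "tile_wires c i = wires @ (if (False, i) \<in> set c then [] else [(1, 4)]) @
     (if (True, i) \<in> set c then [] else [(2, 4)])"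

text \<open>Built from \<open>concat\<close>, \<open>map\<close> and intervals, so that the closure
  rules for \<open>ptime\<close> follow its syntax.\<close>

definition tile_edges :: "nat \<Rightarrow> clause list \<Rightarrow> (nat \<times> nat) list" where
  "tile_edges n D = concat (map (\<lambda>j. concat (map (\<lambda>i.
     map (\<lambda>p. (vid n j (Suc i) (fst p), vid n j (Suc i) (snd p))) (tile_wires (D ! j) i))
     [0..<n])) [0..<length D])"

definition vertical_edges :: "nat \<Rightarrow> nat \<Rightarrow> (nat \<times> nat) list" where
  "vertical_edges n M = concat (map (\<lambda>j. map (\<lambda>i. (vid n j i 19, vid n j (Suc i) 0)) [0..<Suc n]) [0..<M])"

definition horizontal_edges :: "nat \<Rightarrow> nat \<Rightarrow> (nat \<times> nat) list" where
  "horizontal_edges n M = concat (map (\<lambda>j. map (\<lambda>i. (vid n j (Suc i) 17, vid n (Suc j) (Suc i) 1)) [0..<n])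
     [0..<M - 1])"

definition graph_edges :: "nat \<Rightarrow> clause list \<Rightarrow> (nat \<times> nat) list" where
  "graph_edges n D = tile_edges n D @ vertical_edges n (length D) @ horizontal_edges n (length D)"

lemma set_tile_edges: "set (tile_edges n D) =
    {(vid n j (Suc i) a, vid n j (Suc i) b) | j i a b. j < length D \<and> i < n \<and> (a, b) \<in> set (tile_wires (D ! j) i)}"
proof (intro set_eqI iffI)
  fix e assume "e \<in> set (tile_edges n D)"
  then obtain j i p where "j < length D" "i < n" "p \<in> set (tile_wires (D ! j) i)"
    "e = (vid n j (Suc i) (fst p), vid n j (Suc i) (snd p))"
    unfolding tile_edges_def by auto
  then show "e \<in> {(vid n j (Suc i) a, vid n j (Suc i) b) | j i a b.
      j < length D \<and> i < n \<and> (a, b) \<in> set (tile_wires (D ! j) i)}"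
    by (cases p) auto
next
  fix e assume "e \<in> {(vid n j (Suc i) a, vid n j (Suc i) b) | j i a b.
      j < length D \<and> i < n \<and> (a, b) \<in> set (tile_wires (D ! j) i)}"
  then obtain j i a b where "j < length D" "i < n" "(a, b) \<in> set (tile_wires (D ! j) i)"
    "e = (vid n j (Suc i) a, vid n j (Suc i) b)" by blast
  then have "e \<in> set (map (\<lambda>p. (vid n j (Suc i) (fst p), vid n j (Suc i) (snd p))) (tile_wires (D ! j) i))"
    by (auto intro: image_eqI[of _ _ "(a, b)"])
  then have "\<exists>i\<in>set [0..<n]. e \<in> set (map (\<lambda>p. (vid n j (Suc i) (fst p), vid n j (Suc i) (snd p)))
      (tile_wires (D ! j) i))"
    using \<open>i < n\<close> by - (rule bexI[of _ i], simp_all)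
  then have "\<exists>j\<in>set [0..<length D]. \<exists>i\<in>set [0..<n].
      e \<in> set (map (\<lambda>p. (vid n j (Suc i) (fst p), vid n j (Suc i) (snd p))) (tile_wires (D ! j) i))"
    using \<open>j < length D\<close> by - (rule bexI[of _ j], simp_all)
  then show "e \<in> set (tile_edges n D)"
    unfolding tile_edges_def by (simp only: set_concat set_map UN_iff image_image bex_simps)
qed

lemma set_vertical_edges: "set (vertical_edges n M) = {(vid n j i 19, vid n j (Suc i) 0) | j i. j < M \<and> i \<le> n}"
  unfolding vertical_edges_def by (fastforce simp: image_iff less_Suc_eq_le simp del: upt_Suc)

lemma set_horizontal_edges: "set (horizontal_edges n M) =
    {(vid n j (Suc i) 17, vid n (Suc j) (Suc i) 1) | j i. Suc j < M \<and> i < n}"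
  unfolding horizontal_edges_def by (fastforce simp: image_iff)

lemma tile_wires_less:
  assumes "(a, b) \<in> set (tile_wires c i)"
  shows "a < b" "b < 20" "(a, b) \<in> set template"
  using assms by (auto simp: tile_wires_def wires_def template_def split: if_splits)

lemma graph_edges_cases:
  assumes "(u, v) \<in> set (graph_edges n D)"
  obtains (tile) j i a b where "j < length D" "i < n" "(a, b) \<in> set (tile_wires (D ! j) i)"
      "u = vid n j (Suc i) a" "v = vid n j (Suc i) b"
    | (vertical) j i where "j < length D" "i \<le> n" "u = vid n j i 19" "v = vid n j (Suc i) 0"
    | (horizontal) j i where "Suc j < length D" "i < n" "u = vid n j (Suc i) 17" "v = vid n (Suc j) (Suc i) 1"
  using assms unfolding graph_edges_def set_append set_tile_edges set_vertical_edges set_horizontal_edges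
  by blast

lemma vid_less:
  assumes "j < M" "20 * r + l \<le> 20 * n + 20"
  shows "vid n j r l < M * (20 * n + 2)"
proof -
  have "vid n j r l < Suc j * (20 * n + 2)" using assms(2) by (simp add: vid_def)
  also have "\<dots> \<le> M * (20 * n + 2)" using assms(1) by (intro mult_le_mono1) simp
  finally show ?thesis .
qed

lemma graph_edges_less:
  assumes "(u, v) \<in> set (graph_edges n D)"
  shows "u < v" "v < length D * (20 * n + 2)"
  using assms
  by (cases rule: graph_edges_cases; use tile_wires_less in \<open>fastforce intro!: vid_less simp: vid_def\<close>)+

lemma graph_edges_cells:
  assumes "(u, v) \<in> set (graph_edges n D)"
  shows "\<exists>j r a b. (a, b) \<in> set template \<and> cell_of n u = (j, r, a) \<and> cell_of n v = port_cell (j, r, b)"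
  using assms
proof (cases rule: graph_edges_cases)
  case (tile j i a b)
  then have "cell_of n u = (j, Suc i, a)" "cell_of n v = (j, Suc i, b)" "b \<noteq> 20" "b \<noteq> 21"
    using tile_wires_less[OF tile(3)] by (auto intro!: cell_of_vid)
  then have "cell_of n v = port_cell (j, Suc i, b)" by simp
  then show ?thesis using tile_wires_less(3)[OF tile(3)] \<open>cell_of n u = (j, Suc i, a)\<close> by blast
next
  case (vertical j i)
  then have "cell_of n u = (j, i, 19)" "cell_of n v = port_cell (j, i, 21)"
    by (auto intro!: cell_of_vid)
  moreover have "(19, 21) \<in> set template" by (simp add: template_def)
  ultimately show ?thesis by blast
next
  case (horizontal j i)
  then have "cell_of n u = (j, Suc i, 17)" "cell_of n v = port_cell (j, Suc i, 20)"
    by (auto intro!: cell_of_vid)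
  moreover have "(17, 20) \<in> set template" by (simp add: template_def)
  ultimately show ?thesis by blast
qed

definition edge_set :: "(nat \<times> nat) list \<Rightarrow> nat set set" where
  "edge_set xs = {{u, v} | u v. (u, v) \<in> set xs}"

lemma graph_planar: "planar {..<length D * (20 * n + 2)} (edge_set (graph_edges n D))"
proof (rule tile_graph_planar)
  show "inj_on (cell_of n) {..<length D * (20 * n + 2)}" using inj_cell_of by (rule inj_on_subset) simp
  show "snd (snd (cell_of n v)) < 20" for v by (simp add: cell_of_def)
  fix e assume "e \<in> edge_set (graph_edges n D)"
  then obtain u v where e: "e = {u, v}" "(u, v) \<in> set (graph_edges n D)" by (auto simp: edge_set_def)
  then show "\<exists>u\<in>{..<length D * (20 * n + 2)}. \<exists>v\<in>{..<length D * (20 * n + 2)}. \<exists>j r a b.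
      e = {u, v} \<and> (a, b) \<in> set template \<and> cell_of n u = (j, r, a) \<and> cell_of n v = port_cell (j, r, b)"
    using graph_edges_less[OF e(2)] graph_edges_cells[OF e(2)]
    by (intro bexI[of _ u] bexI[of _ v]) auto
qed

lemma graph_simple: "simple_graph {..<length D * (20 * n + 2)} (edge_set (graph_edges n D))"
  unfolding simple_graph_def edge_set_def
proof (intro conjI ballI)
  fix e assume "e \<in> {{u, v} | u v. (u, v) \<in> set (graph_edges n D)}"
  then obtain u v where e: "e = {u, v}" "(u, v) \<in> set (graph_edges n D)" by auto
  then show "\<exists>u\<in>{..<length D * (20 * n + 2)}. \<exists>v\<in>{..<length D * (20 * n + 2)}. u \<noteq> v \<and> e = {u, v}"
    using graph_edges_less[OF e(2)] by (intro bexI[of _ u] bexI[of _ v]) auto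
qed simp

lemma distinct_concat_map:
  assumes "distinct xs" "\<And>x. x \<in> set xs \<Longrightarrow> distinct (f x)"
    and "\<And>x y z. x \<in> set xs \<Longrightarrow> y \<in> set xs \<Longrightarrow> z \<in> set (f x) \<Longrightarrow> z \<in> set (f y) \<Longrightarrow> x = y"
  shows "distinct (concat (map f xs))"
  using assms
proof (induction xs)
  case (Cons x xs)
  have "set (f x) \<inter> set (f y) = {}" if "y \<in> set xs" for y
    using Cons.prems(1) Cons.prems(3)[of x y] that by auto
  moreover have "distinct (concat (map f xs))"
    using Cons.prems by (intro Cons.IH) auto
  ultimately show ?case using Cons.prems(2)[of x] by auto
qed simp

lemma distinct_tile_wires: "distinct (tile_wires c i)"
  by (simp add: tile_wires_def wires_def)

text \<open>\<open>cell_of\<close> recovers the indices from the endpoints. The three kinds do not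
  overlap: a tile edge keeps row and column, a vertical one changes only the row, a horizontal one
  only the column.\<close>

lemma distinct_graph_edges: "distinct (graph_edges n D)"
proof -
  have c1: "cell_of n (vid n j (Suc i) a) = (j, Suc i, a)" if "i < n" "a < 20" for j i a
    using that by (intro cell_of_vid) auto
  have c17: "cell_of n (vid n j (Suc i) 17) = (j, Suc i, 17)" if "i < n" for j i
    using c1[OF that] by simp
  have c2: "cell_of n (vid n j i 19) = (j, i, 19)" "cell_of n (vid n j (Suc i) 0) = (j, Suc i, 0)"
    if "i \<le> n" for j i
    using that by (intro cell_of_vid; simp)+
  have wl: "a < 20" "b < 20" if "(a, b) \<in> set (tile_wires c i)" for a b c i
    using tile_wires_less[OF that] by auto
  have "distinct (tile_edges n D)"
    unfolding tile_edges_def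
  proof (intro distinct_concat_map)
    fix j i assume "j \<in> set [0..<length D]" "i \<in> set [0..<n]"
    then have i: "i < n" by simp
    show "distinct (map (\<lambda>p. (vid n j (Suc i) (fst p), vid n j (Suc i) (snd p))) (tile_wires (D ! j) i))"
      unfolding distinct_map
    proof (intro conjI distinct_tile_wires inj_onI)
      fix p q
      assume *: "p \<in> set (tile_wires (D ! j) i)" "q \<in> set (tile_wires (D ! j) i)"
        "(vid n j (Suc i) (fst p), vid n j (Suc i) (snd p)) = (vid n j (Suc i) (fst q), vid n j (Suc i) (snd q))"
      have "fst p < 20" "snd p < 20" "fst q < 20" "snd q < 20"
        using wl[of "fst p" "snd p" "D ! j" i] wl[of "fst q" "snd q" "D ! j" i] *(1,2) by auto
      then show "p = q" using c1[OF i] *(3) by (metis prod.inject prod_eqI)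
    qed
  next
    fix j i i' z
    assume "i \<in> set [0..<n]" "i' \<in> set [0..<n]"
      "z \<in> set (map (\<lambda>p. (vid n j (Suc i) (fst p), vid n j (Suc i) (snd p))) (tile_wires (D ! j) i))"
      "z \<in> set (map (\<lambda>p. (vid n j (Suc i') (fst p), vid n j (Suc i') (snd p))) (tile_wires (D ! j) i'))"
    then obtain a b a' b' where "i < n" "i' < n" "(a, b) \<in> set (tile_wires (D ! j) i)"
      "(a', b') \<in> set (tile_wires (D ! j) i')" "vid n j (Suc i) a = vid n j (Suc i') a'"
      by auto
    then show "i = i'" using c1[of i a j] c1[of i' a' j] wl by (metis old.nat.inject prod.inject)
  next
    fix j j' z
    let ?f = "\<lambda>j. concat (map (\<lambda>i. map (\<lambda>p. (vid n j (Suc i) (fst p), vid n j (Suc i) (snd p)))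
      (tile_wires (D ! j) i)) [0..<n])"
    assume "z \<in> set (?f j)" "z \<in> set (?f j')"
    then obtain i a b i' a' b' where "i < n" "i' < n" "(a, b) \<in> set (tile_wires (D ! j) i)"
      "(a', b') \<in> set (tile_wires (D ! j') i')" "vid n j (Suc i) a = vid n j' (Suc i') a'"
      by auto
    then show "j = j'" using c1[of i a j] c1[of i' a' j'] wl by (metis prod.inject)
  qed simp_all
  moreover have "distinct (vertical_edges n M)" for M
    unfolding vertical_edges_def
  proof (intro distinct_concat_map)
    fix j
    show "distinct (map (\<lambda>i. (vid n j i 19, vid n j (Suc i) 0)) [0..<Suc n])"
      unfolding distinct_map
      by (intro conjI inj_onI) (auto simp: vid_def simp del: upt_Suc)
  next
    fix j j' z
    assume "z \<in> set (map (\<lambda>i. (vid n j i 19, vid n j (Suc i) 0)) [0..<Suc n])"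
      "z \<in> set (map (\<lambda>i. (vid n j' i 19, vid n j' (Suc i) 0)) [0..<Suc n])"
    then obtain i i' where "i \<le> n" "i' \<le> n" "vid n j i 19 = vid n j' i' 19"
      by (auto simp: less_Suc_eq_le simp del: upt_Suc)
    then show "j = j'" using c2(1)[of i j] c2(1)[of i' j'] by (metis prod.inject)
  qed simp_all
  moreover have "distinct (horizontal_edges n M)" for M
    unfolding horizontal_edges_def
  proof (intro distinct_concat_map)
    fix j
    show "distinct (map (\<lambda>i. (vid n j (Suc i) 17, vid n (Suc j) (Suc i) 1)) [0..<n])"
      unfolding distinct_map
      by (intro conjI inj_onI) (auto simp: vid_def)
  next
    fix j j' z
    assume "z \<in> set (map (\<lambda>i. (vid n j (Suc i) 17, vid n (Suc j) (Suc i) 1)) [0..<n])"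
      "z \<in> set (map (\<lambda>i. (vid n j' (Suc i) 17, vid n (Suc j') (Suc i) 1)) [0..<n])"
    then obtain i i' where "i < n" "i' < n" "vid n j (Suc i) 17 = vid n j' (Suc i') 17" by auto
    then show "j = j'" using c17[of i j] c17[of i' j']
      by (metis prod.inject)
  qed simp_all
  moreover have "set (tile_edges n D) \<inter> set (vertical_edges n M) = {}" for M
  proof -
    have False if h: "(u, v) \<in> set (tile_edges n D)" "(u, v) \<in> set (vertical_edges n M)" for u v
    proof -
      obtain j i a b where "i < n" "(a, b) \<in> set (tile_wires (D ! j) i)"
        "u = vid n j (Suc i) a" "v = vid n j (Suc i) b" using h(1) unfolding set_tile_edges by blast
      then have "fst (snd (cell_of n u)) = fst (snd (cell_of n v))" using c1[of i] wl by auto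
      moreover obtain j i where "i \<le> n" "u = vid n j i 19" "v = vid n j (Suc i) 0"
        using h(2) unfolding set_vertical_edges by blast
      ultimately show False using c2[of i j] by simp
    qed
    then show ?thesis by auto
  qed
  moreover have "set (tile_edges n D) \<inter> set (horizontal_edges n M) = {}" for M
  proof -
    have False if h: "(u, v) \<in> set (tile_edges n D)" "(u, v) \<in> set (horizontal_edges n M)" for u v
    proof -
      obtain j i a b where "i < n" "(a, b) \<in> set (tile_wires (D ! j) i)"
        "u = vid n j (Suc i) a" "v = vid n j (Suc i) b" using h(1) unfolding set_tile_edges by blast
      then have "fst (cell_of n u) = fst (cell_of n v)" using c1[of i] wl by auto
      moreover obtain j i where "i < n" "u = vid n j (Suc i) 17" "v = vid n (Suc j) (Suc i) 1"
        using h(2) unfolding set_horizontal_edges by blast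
      ultimately show False using c1[of i 17 j] c1[of i 1 "Suc j"] by simp
    qed
    then show ?thesis by auto
  qed
  moreover have "set (vertical_edges n M) \<inter> set (horizontal_edges n M) = {}" for M
  proof -
    have False if h: "(u, v) \<in> set (vertical_edges n M)" "(u, v) \<in> set (horizontal_edges n M)" for u v
    proof -
      obtain j i where "i \<le> n" "u = vid n j i 19" "v = vid n j (Suc i) 0"
        using h(1) unfolding set_vertical_edges by blast
      then have "fst (cell_of n u) = fst (cell_of n v)" using c2[of i j] by simp
      moreover obtain j i where "i < n" "u = vid n j (Suc i) 17" "v = vid n (Suc j) (Suc i) 1"
        using h(2) unfolding set_horizontal_edges by blast
      ultimately show False using c1[of i 17 j] c1[of i 1 "Suc j"] by simp
    qed
    then show ?thesis by auto
  qed
  ultimately show ?thesis unfolding graph_edges_def by (simp add: Int_Un_distrib)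
qed

text \<open>Vertex v has position \<open>Suc v\<close>, so it lies left of the cut iff v < p. The
  horizontal edges of one row span disjoint stretches of the layout, so at most one per row crosses;
  all other edges are short.\<close>

lemma cut_bound:
  assumes "p > 0"
  shows "card {e \<in> edge_set (graph_edges n D). \<exists>u v. e = {u, v} \<and> Suc u \<le> p \<and> p < Suc v} \<le> n + 361"
proof -
  \<comment> \<open>Tile edges and vertical edges span at most 19 positions, so both ends lie within
    19 of the cut; 361 is 19 squared.\<close>
  define L where "L = {p - 19..<p} \<times> {p..<p + 19}"
  define H where "H = {(u, v) \<in> set (horizontal_edges n (length D)). u < p \<and> p \<le> v}"
  have H: "card H \<le> n"
  proof -
    \<comment> \<open>The row determines the crossing edge, so \<open>THE\<close> presents
      \<open>H\<close> as part of an image of the n rows.\<close>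
    have "H \<subseteq> (\<lambda>i. THE q. q \<in> H \<and> fst (snd (cell_of n (fst q))) = Suc i) ` {..<n}"
    proof
      fix q assume q: "q \<in> H"
      then obtain j i where ji: "i < n" "q = (vid n j (Suc i) 17, vid n (Suc j) (Suc i) 1)"
        "vid n j (Suc i) 17 < p" "p \<le> vid n (Suc j) (Suc i) 1"
        unfolding H_def set_horizontal_edges by blast
      have "(THE q. q \<in> H \<and> fst (snd (cell_of n (fst q))) = Suc i) = q"
      proof (rule the_equality)
        show "q \<in> H \<and> fst (snd (cell_of n (fst q))) = Suc i"
          using q ji cell_of_vid[of 17 "Suc i" n j] by simp
        fix q' assume q': "q' \<in> H \<and> fst (snd (cell_of n (fst q'))) = Suc i"
        then obtain j' i' where ji': "i' < n" "q' = (vid n j' (Suc i') 17, vid n (Suc j') (Suc i') 1)"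
          "vid n j' (Suc i') 17 < p" "p \<le> vid n (Suc j') (Suc i') 1"
          unfolding H_def set_horizontal_edges by blast
        have "i' = i" using q' ji' cell_of_vid[of 17 "Suc i'" n j'] by simp
        have less: "vid n (Suc j) (Suc i) 1 \<le> vid n j' (Suc i) 17" if "j < j'" for j j'
        proof -
          have "Suc j * (20 * n + 2) \<le> j' * (20 * n + 2)" using that by (intro mult_le_mono1) simp
          then show ?thesis by (simp add: vid_def)
        qed
        have "j' = j"
          using less[of j j'] less[of j' j] ji(3,4) ji'(3,4) \<open>i' = i\<close> by (meson leD le_trans linorder_neqE_nat)
        then show "q' = q" using \<open>i' = i\<close> ji ji' by simp
      qed
      then show "q \<in> (\<lambda>i. THE q. q \<in> H \<and> fst (snd (cell_of n (fst q))) = Suc i) ` {..<n}"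
        using ji(1) by (intro image_eqI[of _ _ i]) auto
    qed
    from surj_card_le[OF finite_lessThan this] show ?thesis by simp
  qed
  have fin: "finite H"
    by (rule finite_subset[of _ "set (horizontal_edges n (length D))"]) (auto simp: H_def)
  have L: "card L \<le> 361" "finite L"
  proof -
    have "card {p - 19..<p} \<le> 19" by simp
    then have "card L \<le> 19 * 19" unfolding L_def card_cartesian_product by (intro mult_le_mono) simp_all
    then show "card L \<le> 361" by simp
  qed (simp add: L_def)
  have "{e \<in> edge_set (graph_edges n D). \<exists>u v. e = {u, v} \<and> Suc u \<le> p \<and> p < Suc v}
      \<subseteq> (\<lambda>(u, v). {u, v}) ` (L \<union> H)"
  proof
    fix e assume "e \<in> {e \<in> edge_set (graph_edges n D). \<exists>u v. e = {u, v} \<and> Suc u \<le> p \<and> p < Suc v}"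
    then obtain u v u' v' where e: "e = {u, v}" "e = {u', v'}" "u < p" "p \<le> v" "(u', v') \<in> set (graph_edges n D)"
      by (auto simp: edge_set_def)
    have "u' < v'" using graph_edges_less[OF e(5)] by simp
    then have "u' = u" "v' = v" using e(1-4) by (auto simp: doubleton_eq_iff)
    from e(5) have "(u', v') \<in> L \<union> H"
    proof (cases rule: graph_edges_cases)
      case (tile j i a b)
      then have "v' \<le> u' + 19" using tile_wires_less[OF tile(3)] by (auto simp: vid_def)
      then show ?thesis using e(3,4) \<open>u' = u\<close> \<open>v' = v\<close> by (auto simp: L_def)
    next
      case (vertical j i)
      then have "v' \<le> u' + 19" by (auto simp: vid_def)
      then show ?thesis using e(3,4) \<open>u' = u\<close> \<open>v' = v\<close> by (auto simp: L_def)
    next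
      case (horizontal j i)
      then have "(u', v') \<in> set (horizontal_edges n (length D))"
        unfolding set_horizontal_edges by blast
      then show ?thesis using e(3,4) \<open>u' = u\<close> \<open>v' = v\<close> by (auto simp: H_def)
    qed
    then show "e \<in> (\<lambda>(u, v). {u, v}) ` (L \<union> H)" using e(2) by (intro image_eqI[of _ _ "(u', v')"]) auto
  qed
  then have "card {e \<in> edge_set (graph_edges n D). \<exists>u v. e = {u, v} \<and> Suc u \<le> p \<and> p < Suc v} \<le> card (L \<union> H)"
    by (rule surj_card_le[rotated]) (use L(2) fin in simp)
  also have "\<dots> \<le> n + 361" using card_Un_le[of L H] H L(1) by linarith
  finally show ?thesis .
qed

section \<open>Correctness of the reduction\<close>

lemma sum_column:
  fixes f :: "nat \<Rightarrow> nat"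
  shows "(\<Sum>w<20 * n + 2. f w) = f 0 + (\<Sum>i<n. \<Sum>l<20. f (Suc (20 * i + l))) + f (Suc (20 * n))"
proof -
  have "(\<Sum>w<20 * n + 2. f w) = f 0 + (\<Sum>w<20 * n. f (Suc w)) + f (Suc (20 * n))"
    using sum.lessThan_Suc_shift[of f "Suc (20 * n)"] by simp
  moreover have "(\<Sum>w<20 * n. f (Suc w)) = (\<Sum>i<n. \<Sum>l<20. f (Suc (20 * i + l)))"
  proof (induction n)
    case (Suc n)
    have "(\<Sum>w<20 * Suc n. f (Suc w)) = (\<Sum>w<20 * n + 20. f (Suc w))" by (simp add: add.commute)
    also have "\<dots> = (\<Sum>w<20 * n. f (Suc w)) + (\<Sum>l<20. f (Suc (20 * n + l)))"
      using sum.atLeastLessThan_concat[of 0 "20 * n" "20 * n + 20" "\<lambda>w. f (Suc w)"]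
        sum.shift_bounds_nat_ivl[of "\<lambda>w. f (Suc w)" 0 "20 * n" 20]
      by (simp add: lessThan_atLeast0 add.commute)
    finally show ?case using Suc by simp
  qed simp
  ultimately show ?thesis by simp
qed

text \<open>Groups a column into its starting vertex, n tiles and its final vertex, to match the
  maximum 1 + 8 * n + 1.\<close>

lemma sum_cells:
  fixes f :: "nat \<Rightarrow> nat"
  shows "(\<Sum>v<M * (20 * n + 2). f v) = (\<Sum>j<M. f (vid n j 0 19) +
    (\<Sum>i<n. \<Sum>l<20. f (vid n j (Suc i) l)) + f (vid n j (Suc n) 0))"
proof -
  define q where "q = 20 * n + 2"
  have "(\<Sum>v<M * q. f v) = (\<Sum>j<M. \<Sum>w<q. f (j * q + w))"
  proof (induction M)
    case (Suc M)
    have "(\<Sum>v<Suc M * q. f v) = (\<Sum>v<M * q + q. f v)" by (simp add: add.commute)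
    also have "\<dots> = (\<Sum>v<M * q. f v) + (\<Sum>w<q. f (M * q + w))"
      using sum.atLeastLessThan_concat[of 0 "M * q" "M * q + q" f]
        sum.shift_bounds_nat_ivl[of f 0 "M * q" q]
      by (simp add: lessThan_atLeast0 add.commute)
    finally show ?case using Suc by simp
  qed simp
  also have "\<dots> = (\<Sum>j<M. f (vid n j 0 19) +
    (\<Sum>i<n. \<Sum>l<20. f (vid n j (Suc i) l)) + f (vid n j (Suc n) 0))"
    unfolding q_def sum_column vid_def by (simp add: algebra_simps)
  finally show ?thesis unfolding q_def .
qed

lemma card_as_sum:
  fixes N :: nat
  assumes "S \<subseteq> {..<N}"
  shows "card S = (\<Sum>v<N. of_bool (v \<in> S))"
proof -
  have "{..<N} \<inter> S = S" using assms by blast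
  then show ?thesis by simp
qed

lemma sum_tight:
  fixes f :: "'a \<Rightarrow> nat"
  assumes "finite A" "\<And>x. x \<in> A \<Longrightarrow> f x \<le> c" "sum f A = card A * c" "x \<in> A"
  shows "f x = c"
  using sum_mono_inv[of f A "\<lambda>_. c" x] assms by (simp add: mult.commute)

text \<open>The values of a variable read in successive columns can only increase, because the single
  edge between neighbouring tiles forbids just one of the two kinds of disagreement.\<close>

lemma independent_set_sound:
  assumes S: "independent_set {..<length D * (20 * n + 2)} (edge_set (graph_edges n D)) S"
    and card: "card S = length D * (8 * n + 2)"
  defines "X \<equiv> \<lambda>j i. vid n j (Suc i) 2 \<in> S"
  shows "Suc j < length D \<Longrightarrow> i < n \<Longrightarrow> X j i \<Longrightarrow> X (Suc j) i"
    and "j < length D \<Longrightarrow> \<exists>(b, i)\<in>set (D ! j). X j i = b"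
proof -
  let ?o = "\<lambda>v. of_bool (v \<in> S) :: nat"
  have indep: "\<not> (u \<in> S \<and> v \<in> S)" if "(u, v) \<in> set (graph_edges n D)" for u v
  proof -
    have "{u, v} \<in> edge_set (graph_edges n D)" using that by (auto simp: edge_set_def)
    then show ?thesis
      using S graph_edges_less(1)[OF that] unfolding independent_set_def pairwise_def by (metis nat_neq_iff)
  qed
  have e: "\<not> (vid n j (Suc i) a \<in> S \<and> vid n j (Suc i) b \<in> S)"
    if "j < length D" "i < n" "(a, b) \<in> set (tile_wires (D ! j) i)" for j i a b
    using that by (intro indep) (auto simp: graph_edges_def set_tile_edges)
  have vert: "\<not> (vid n j i 19 \<in> S \<and> vid n j (Suc i) 0 \<in> S)" if "j < length D" "i \<le> n" for j i
    using that by (intro indep) (auto simp: graph_edges_def set_vertical_edges)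
  have horiz: "\<not> (vid n j (Suc i) 17 \<in> S \<and> vid n (Suc j) (Suc i) 1 \<in> S)"
    if "Suc j < length D" "i < n" for j i
    using that by (intro indep) (auto simp: graph_edges_def set_horizontal_edges)
  have w: "(a, b) \<in> set (tile_wires c i)" if "(a, b) \<in> set wires" for a b c i
    using that by (simp add: tile_wires_def)
  have ti: "tile_indep (\<lambda>l. vid n j (Suc i) l \<in> S)" if "j < length D" "i < n" for j i
    unfolding tile_indep_def using e[OF that w] by blast
  let ?t = "\<lambda>j i. \<Sum>l<20. ?o (vid n j (Suc i) l)"
  let ?col = "\<lambda>j. ?o (vid n j 0 19) + (\<Sum>i<n. ?t j i) + ?o (vid n j (Suc n) 0)"
  have t8: "?t j i \<le> 8" if "j < length D" "i < n" for j i
    using tile_bound(1)[OF ti[OF that]] .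
  have ts: "(\<Sum>i<n. ?t j i) \<le> 8 * n" if "j < length D" for j
    using sum_bounded_above[of "{..<n}" "?t j" 8] t8[OF that] by (simp add: mult.commute)
  have "?col j \<le> 8 * n + 2" if "j < length D" for j
    using ts[OF that] by (simp add: of_bool_def)
  moreover have "(\<Sum>j<length D. ?col j) = length D * (8 * n + 2)"
    using card card_as_sum[of S "length D * (20 * n + 2)"] S
    by (simp only: sum_cells independent_set_def)
  \<comment> \<open>The target is the sum of the column maxima, so every column is tight; then both
    end vertices are taken and every tile has 8.\<close>
  ultimately have col: "?col j = 8 * n + 2" if "j < length D" for j
    using sum_tight[of "{..<length D}" ?col "8 * n + 2" j] that by simp
  have top: "vid n j 0 19 \<in> S" and bot: "vid n j (Suc n) 0 \<in> S" and sum: "(\<Sum>i<n. ?t j i) = 8 * n"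
    if "j < length D" for j
    using col[OF that] ts[OF that] by (auto simp: of_bool_def split: if_splits)
  have full: "(vid n j (Suc i) 1 \<in> S \<or> vid n j (Suc i) 2 \<in> S) \<and>
      (vid n j (Suc i) 0 \<in> S \<or> vid n j (Suc i) 3 \<in> S \<or> vid n j (Suc i) 4 \<in> S) \<and>
      (vid n j (Suc i) 5 \<in> S \<or> vid n j (Suc i) 17 \<in> S) \<and>
      (vid n j (Suc i) 7 \<in> S \<or> vid n j (Suc i) 19 \<in> S)" if "j < length D" "i < n" for j i
  proof (rule tile_bound(2)[OF ti[OF that]])
    show "?t j i = 8"
      using sum_tight[of "{..<n}" "?t j" 8 i] t8[OF that(1)] sum[OF that(1)] that(2) by (simp add: mult.commute)
  qed
  show "X (Suc j) i" if "Suc j < length D" "i < n" "X j i"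
  proof -
    have j: "j < length D" using that(1) by simp
    \<comment> \<open>Vertex 2 excludes 5, tightness forces 17, the horizontal edge excludes 1 in
      the next tile, and tightness forces 2 there.\<close>
    have "vid n j (Suc i) 5 \<notin> S"
      using e[OF j that(2) w, of 2 5] that(3) by (simp add: wires_def X_def)
    then show ?thesis
      using full[OF j that(2)] horiz[OF that(1,2)] full[OF that(1,2)] by (auto simp: X_def)
  qed
  show "\<exists>(b, i)\<in>set (D ! j). X j i = b" if j: "j < length D"
  proof -
    \<comment> \<open>Otherwise the signal runs down the whole column: 19 excludes 0 below it, so 3
      is chosen, 7 is not, and 19 is again. At the bottom it collides with the final vertex.\<close>
    have "\<exists>i<n. vid n j (Suc i) 4 \<in> S"
    proof (rule ccontr)
      assume neg: "\<not> ?thesis"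
      have "vid n j i 19 \<in> S" if "i \<le> n" for i
        using that
      proof (induction i)
        case (Suc i)
        then have "vid n j (Suc i) 0 \<notin> S" using vert[OF j, of i] by simp
        then have "vid n j (Suc i) 3 \<in> S" using full[OF j, of i] neg Suc.prems by auto
        then have "vid n j (Suc i) 7 \<notin> S"
          using e[OF j _ w, of i 3 7] Suc.prems by (simp add: wires_def)
        then show ?case using full[OF j, of i] Suc.prems by auto
      qed (use top[OF j] in simp)
      then show False using vert[OF j order.refl] bot[OF j] by blast
    qed
    then obtain i where i: "i < n" "vid n j (Suc i) 4 \<in> S" by blast
    \<comment> \<open>Otherwise the optional edge from 4 to the chosen value vertex would be
      present.\<close>
    have "(X j i, i) \<in> set (D ! j)"
    proof (rule ccontr)
      assume neg: "(X j i, i) \<notin> set (D ! j)"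
      show False
      proof (cases "X j i")
        case True
        then show False using neg e[OF j i(1), of 2 4] i by (simp add: tile_wires_def X_def)
      next
        case False
        then have "vid n j (Suc i) 1 \<in> S" using full[OF j i(1)] by (simp add: X_def)
        then show False using False neg e[OF j i(1), of 1 4] i by (simp add: tile_wires_def)
      qed
    qed
    then show ?thesis by blast
  qed
qed

text \<open>In each column the first row with a satisfied literal absorbs the signal; the tiles
  above pass it on and those below are idle.\<close>

lemma independent_set_complete:
  assumes sat: "\<And>j. j < length D \<Longrightarrow> \<exists>(b, i)\<in>set (D ! j). a i = b"
    and vars: "\<And>j b i. j < length D \<Longrightarrow> (b, i) \<in> set (D ! j) \<Longrightarrow> i < n"
  shows "\<exists>S. independent_set {..<length D * (20 * n + 2)} (edge_set (graph_edges n D)) S \<and>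
    card S = length D * (8 * n + 2)"
proof -
  define h where "h j = (LEAST i. (a i, i) \<in> set (D ! j))" for j
  have h: "(a (h j), h j) \<in> set (D ! j)" "h j < n" if "j < length D" for j
  proof -
    have "\<exists>i. (a i, i) \<in> set (D ! j)" using sat[OF that] by auto
    then show "(a (h j), h j) \<in> set (D ! j)" unfolding h_def by (rule LeastI_ex)
    then show "h j < n" using vars that by blast
  qed
  define k where "k j i = (if i < h j then 3 else if i = h j then 4 else 0 :: nat)" for j i
  have k: "k j i \<in> {0, 3, 4}" for j i by (simp add: k_def)
  \<comment> \<open>Rows 0 and n + 1 have a single vertex each, always taken; row r in between holds
    variable r - 1.\<close>
  define P where "P c = (case c of (j, r, l) \<Rightarrow> r = 0 \<or> r = Suc n \<or> l \<in> tile_state (a (r - 1)) (k j (r - 1)))"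
    for c
  define S where "S = {v. v < length D * (20 * n + 2) \<and> P (cell_of n v)}"
  have mem: "vid n j (Suc i) l \<in> S \<longleftrightarrow> l \<in> tile_state (a i) (k j i)"
    if "j < length D" "i < n" "l < 20" for j i l
    using that vid_less[of j "length D" "Suc i" l n] cell_of_vid[of l "Suc i" n j]
    by (simp add: S_def P_def)
  have top: "vid n j 0 19 \<in> S" if "j < length D" for j
    using that vid_less[of j "length D" 0 19 n] cell_of_vid[of 19 0 n j] by (simp add: S_def P_def)
  have bot: "vid n j (Suc n) 0 \<in> S" if "j < length D" for j
    using that vid_less[of j "length D" "Suc n" 0 n] cell_of_vid[of 0 "Suc n" n j] by (simp add: S_def P_def)
  have "\<not> (u \<in> S \<and> v \<in> S)" if "(u, v) \<in> set (graph_edges n D)" for u v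
    using that
  proof (cases rule: graph_edges_cases)
    case (tile j i x y)
    note xy = tile_wires_less[OF tile(3)]
    have "\<not> (x \<in> tile_state (a i) (k j i) \<and> y \<in> tile_state (a i) (k j i))"
    proof (cases "(x, y) \<in> set wires")
      case True
      then show ?thesis using tile_state(1)[OF k, of "a i" j i] unfolding tile_indep_def by blast
    next
      case False
      then have "(x, y) = (1, 4) \<and> (False, i) \<notin> set (D ! j) \<or> (x, y) = (2, 4) \<and> (True, i) \<notin> set (D ! j)"
        using tile(3) by (auto simp: tile_wires_def split: if_splits)
      moreover have "k j i = 4 \<Longrightarrow> (a i, i) \<in> set (D ! j)"
        using h(1)[OF tile(1)] by (auto simp: k_def split: if_splits)
      ultimately show ?thesis
        using tile_state(4,5,8)[OF k, of "a i" j i] by auto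
    qed
    then show ?thesis using mem[OF tile(1,2)] xy tile(4,5) by auto
  next
    \<comment> \<open>The upper end is taken iff i \<le> h j and the lower end iff i > h j; rows 0
      and n + 1 conform because h j < n.\<close>
    case (vertical j i)
    have hn: "h j < n" using h(2) vertical(1) by blast
    show ?thesis
    proof (cases "i = 0")
      case True
      have "vid n j (Suc 0) 0 \<notin> S"
        using mem[OF vertical(1), of 0 0] hn tile_state(7)[OF k, of "a 0" j 0] by (simp add: k_def)
      then show ?thesis using vertical True by simp
    next
      case False
      then obtain i' where i': "i = Suc i'" "i' < n" using vertical(2) by (cases i) auto
      show ?thesis
      proof (cases "i' < h j")
        case True
        then have "i < n" using i' hn by simp
        then have "vid n j (Suc i) 0 \<notin> S"
          using mem[OF vertical(1), of i 0] tile_state(7)[OF k, of "a i" j i] True i' by (simp add: k_def)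
        then show ?thesis using vertical by simp
      next
        case False
        then have "vid n j i 19 \<notin> S"
          using mem[OF vertical(1), of i' 19] tile_state(9)[OF k, of "a i'" j i'] i' by (simp add: k_def)
        then show ?thesis using vertical by simp
      qed
    qed
  next
    case (horizontal j i)
    have j: "j < length D" using horizontal(1) by simp
    show ?thesis
      using mem[OF j horizontal(2), of 17] mem[OF horizontal(1,2), of 1]
        tile_state(6)[OF k, of "a i" j i] tile_state(4)[OF k, of "a i" "Suc j" i] horizontal(3,4)
      by simp
  qed
  then have "independent_set {..<length D * (20 * n + 2)} (edge_set (graph_edges n D)) S"
    unfolding independent_set_def pairwise_def edge_set_def
    by (auto simp: S_def doubleton_eq_iff)
  moreover have "card S = length D * (8 * n + 2)"
  proof -
    have "(\<Sum>l<20. of_bool (vid n j (Suc i) l \<in> S)) = (8 :: nat)" if "j < length D" "i < n" for j i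
    proof -
      have "(\<Sum>l<20. of_bool (vid n j (Suc i) l \<in> S)) = (\<Sum>l<20. of_bool (l \<in> tile_state (a i) (k j i)) :: nat)"
        using mem[OF that] by (intro sum.cong) auto
      also have "\<dots> = card (tile_state (a i) (k j i))"
        using card_as_sum[OF tile_state(3)[OF k]] by simp
      finally show ?thesis using tile_state(2)[OF k] by simp
    qed
    then have "(\<Sum>j<length D. of_bool (vid n j 0 19 \<in> S) +
      (\<Sum>i<n. \<Sum>l<20. of_bool (vid n j (Suc i) l \<in> S)) + of_bool (vid n j (Suc n) 0 \<in> S)) =
      (\<Sum>j<length D. 8 * n + 2 :: nat)"
      using top bot by (intro sum.cong) (simp_all add: mult.commute)
    moreover have "S \<subseteq> {..<length D * (20 * n + 2)}" by (auto simp: S_def)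
    ultimately have "card S = (\<Sum>j<length D. 8 * n + 2)" by (simp only: card_as_sum sum_cells)
    then show ?thesis by simp
  qed
  ultimately show ?thesis by blast
qed

section \<open>The repeated clause list and the reduction\<close>

definition columns :: "cnf \<Rightarrow> clause list" where
  "columns \<phi> = concat (map (\<lambda>_. clauses \<phi>) [0..<Suc (num_vars \<phi>)])"

lemma length_columns: "length (columns \<phi>) = Suc (num_vars \<phi>) * length (clauses \<phi>)"
  by (simp add: columns_def length_concat o_def sum_list_triv del: upt_Suc)

lemma nth_concat_const:
  "b < length xs \<Longrightarrow> k < length ys \<Longrightarrow> concat (map (\<lambda>_. ys) xs) ! (b * length ys + k) = ys ! k"
proof (induction xs arbitrary: b)
  case (Cons x xs)
  then show ?case by (cases b) (auto simp: nth_append)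
qed simp

lemma columns_nth:
  "b \<le> num_vars \<phi> \<Longrightarrow> k < length (clauses \<phi>) \<Longrightarrow>
    columns \<phi> ! (b * length (clauses \<phi>) + k) = clauses \<phi> ! k"
  unfolding columns_def by (rule nth_concat_const) (simp_all del: upt_Suc)

text \<open>Each of the \<open>n\<close> variables can switch only once, so in one of the \<open>n + 1\<close> copies of the clause
  list no variable switches.\<close>

lemma stable_block:
  fixes X :: "nat \<Rightarrow> nat \<Rightarrow> bool"
  assumes mono: "\<And>j i. Suc j < Suc n * m \<Longrightarrow> i < n \<Longrightarrow> X j i \<Longrightarrow> X (Suc j) i" and m: "m > 0"
  shows "\<exists>b\<le>n. \<forall>k<m. \<forall>i<n. X (b * m + k) i = X (b * m) i"
proof (rule ccontr)
  assume neg: "\<not> ?thesis"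
  have mono': "X j' i" if "j \<le> j'" "j' < Suc n * m" "i < n" "X j i" for j j' i
    using that
  proof (induction j' rule: dec_induct)
    case (step j')
    then show ?case using mono[of j' i] by simp
  qed
  \<comment> \<open>A potential: the number of true variables in column j. It never decreases and,
    without a stable block, grows inside each of the n + 1 blocks, hence beyond n.\<close>
  define c where "c j = card {i. i < n \<and> X j i}" for j
  have c_mono: "c j \<le> c j'" if "j \<le> j'" "j' < Suc n * m" for j j'
    unfolding c_def by (rule card_mono) (use mono'[OF that] in auto)
  have bm: "b * m + k < Suc n * m" if "b \<le> n" "k < m" for b k
  proof -
    have "b * m + k < Suc b * m" using that(2) by simp
    also have "\<dots> \<le> Suc n * m" using that(1) by (intro mult_le_mono1) simp
    finally show ?thesis .
  qed
  have inc: "c (b * m) < c (b * m + (m - 1))" if b: "b \<le> n" for b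
  proof -
    obtain k i where ki: "k < m" "i < n" "X (b * m + k) i \<noteq> X (b * m) i" using neg b by blast
    have l: "b * m + (m - 1) < Suc n * m" by (rule bm[OF b]) (use m in simp)
    have "\<not> X (b * m) i" "X (b * m + k) i"
      using ki mono'[of "b * m" "b * m + k" i] bm[OF b ki(1)] by auto
    moreover have "X (b * m + (m - 1)) i"
      using mono'[OF _ l ki(2), of "b * m + k"] ki(1) calculation(2) by simp
    ultimately have "i \<in> {i. i < n \<and> X (b * m + (m - 1)) i} - {i. i < n \<and> X (b * m) i}"
      using ki(2) by simp
    moreover have "{i. i < n \<and> X (b * m) i} \<subseteq> {i. i < n \<and> X (b * m + (m - 1)) i}"
      using mono'[where j = "b * m", OF _ l] by auto
    ultimately show ?thesis unfolding c_def by (intro psubset_card_mono) auto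
  qed
  have "b < c (b * m + (m - 1))" if "b \<le> n" for b
    using that
  proof (induction b)
    case 0
    then show ?case using inc[of 0] by simp
  next
    case (Suc b)
    have "c (b * m + (m - 1)) \<le> c (Suc b * m)"
    proof (rule c_mono)
      show "b * m + (m - 1) \<le> Suc b * m" by simp
      show "Suc b * m < Suc n * m" using bm[OF Suc.prems m] by (simp only: add_0_right)
    qed
    then show ?case using Suc inc[OF Suc.prems] by simp
  qed
  from this[of n] have "n < c (n * m + (m - 1))" by simp
  moreover have "c j \<le> n" for j
    unfolding c_def using card_mono[of "{..<n}" "{i. i < n \<and> X j i}"] by auto
  ultimately show False by (meson leD)
qed

definition reduce :: "cnf \<Rightarrow> is_instance" where
  "reduce \<phi> = IS_Instance (length (columns \<phi>) * (20 * num_vars \<phi> + 2))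
     (graph_edges (num_vars \<phi>) (columns \<phi>))
     (map Suc [0..<length (columns \<phi>) * (20 * num_vars \<phi> + 2)])
     (length (columns \<phi>) * (8 * num_vars \<phi> + 2))"

lemma reduce_sel:
  "verts (reduce \<phi>) = {..<length (columns \<phi>) * (20 * num_vars \<phi> + 2)}"
  "edges (reduce \<phi>) = edge_set (graph_edges (num_vars \<phi>) (columns \<phi>))"
  by (simp_all add: verts_def edges_def reduce_def edge_set_def)

lemma layout_reduce: "v < length (columns \<phi>) * (20 * num_vars \<phi> + 2) \<Longrightarrow> layout (reduce \<phi>) v = Suc v"
  by (simp add: layout_def reduce_def)

lemma reduce_correct:
  assumes "\<phi> \<in> qSAT_inputs q"
  shows "has_independent_set (reduce \<phi>) \<longleftrightarrow> satisfiable \<phi>"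
proof
  let ?D = "columns \<phi>" and ?n = "num_vars \<phi>" and ?F = "clauses \<phi>"
  assume "has_independent_set (reduce \<phi>)"
  then obtain S where S: "independent_set {..<length ?D * (20 * ?n + 2)} (edge_set (graph_edges ?n ?D)) S"
    "card S = length ?D * (8 * ?n + 2)"
    unfolding has_independent_set_def reduce_sel by (auto simp: reduce_def)
  note sound = independent_set_sound[OF S]
  let ?X = "\<lambda>j i. vid ?n j (Suc i) 2 \<in> S"
  show "satisfiable \<phi>"
  \<comment> \<open>Without clauses the blocks are empty, whereas \<open>stable_block\<close> needs
    positive length.\<close>
  proof (cases "?F = []")
    case True
    then show ?thesis by (simp add: satisfiable_def satisfies_def)
  next
    case False
    then have "\<exists>b\<le>?n. \<forall>k<length ?F. \<forall>i<?n. ?X (b * length ?F + k) i = ?X (b * length ?F) i"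
      using sound(1) by (intro stable_block) (simp_all add: length_columns)
    then obtain b where b: "b \<le> ?n"
      "\<And>k i. k < length ?F \<Longrightarrow> i < ?n \<Longrightarrow> ?X (b * length ?F + k) i = ?X (b * length ?F) i" by blast
    have "\<exists>(s, i)\<in>set (?F ! k). ?X (b * length ?F) i = s" if k: "k < length ?F" for k
    proof -
      have "b * length ?F + k < Suc b * length ?F" using k by simp
      also have "\<dots> \<le> length ?D" unfolding length_columns using b(1) by (intro mult_le_mono1) simp
      finally obtain s i where si: "(s, i) \<in> set (?D ! (b * length ?F + k))" "?X (b * length ?F + k) i = s"
        using sound(2) by blast
      have "(s, i) \<in> set (?F ! k)" using si(1) columns_nth[OF b(1) k] by simp
      moreover have "i < ?n"
        using assms calculation k unfolding qSAT_inputs_def by (fastforce simp: all_set_conv_all_nth)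
      ultimately show ?thesis using b(2)[OF k] si(2) by blast
    qed
    then have "satisfies (?X (b * length ?F)) ?F"
      unfolding satisfies_def by (simp add: all_set_conv_all_nth)
    then show ?thesis unfolding satisfiable_def by blast
  qed
next
  let ?D = "columns \<phi>" and ?n = "num_vars \<phi>" and ?F = "clauses \<phi>"
  assume "satisfiable \<phi>"
  then obtain a where a: "satisfies a ?F" unfolding satisfiable_def by blast
  have sub: "?D ! j \<in> set ?F" if "j < length ?D" for j
    using nth_mem[OF that] unfolding columns_def by (auto simp del: upt_Suc)
  have "\<exists>S. independent_set {..<length ?D * (20 * ?n + 2)} (edge_set (graph_edges ?n ?D)) S \<and>
    card S = length ?D * (8 * ?n + 2)"
  proof (rule independent_set_complete)
    show "\<exists>(b, i)\<in>set (?D ! j). a i = b" if "j < length ?D" for j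
      using a sub[OF that] unfolding satisfies_def by blast
    show "i < ?n" if "j < length ?D" "(b, i) \<in> set (?D ! j)" for j b i
      using assms sub[OF that(1)] that(2) unfolding qSAT_inputs_def by blast
  qed
  then show "has_independent_set (reduce \<phi>)"
    unfolding has_independent_set_def reduce_sel by (auto simp: reduce_def)
qed

lemma reduce_input: "reduce \<phi> \<in> planar_layout_inputs"
proof -
  let ?N = "length (columns \<phi>) * (20 * num_vars \<phi> + 2)"
  have "bij_betw Suc {..<?N} {1..?N}"
    by (rule bij_betwI[of _ _ _ "\<lambda>x. x - 1"]) auto
  then have "linear_layout (verts (reduce \<phi>)) (layout (reduce \<phi>))"
    unfolding linear_layout_def reduce_sel
    by (subst bij_betw_cong[of _ _ Suc]) (auto simp: layout_reduce)
  then show ?thesis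
    unfolding planar_layout_inputs_def
    using distinct_graph_edges[of "num_vars \<phi>" "columns \<phi>"] graph_planar[of "columns \<phi>" "num_vars \<phi>"]
      graph_simple[of "columns \<phi>" "num_vars \<phi>"] graph_edges_less(1)[of _ _ "num_vars \<phi>" "columns \<phi>"]
    by (auto simp: reduce_sel) (auto simp: reduce_def)
qed

lemma reduce_cutwidth: "instance_cutwidth (reduce \<phi>) \<le> num_vars \<phi> + 361"
proof -
  let ?N = "length (columns \<phi>) * (20 * num_vars \<phi> + 2)"
  let ?E = "edge_set (graph_edges (num_vars \<phi>) (columns \<phi>))"
  have "card {e \<in> ?E. \<exists>u v. e = {u, v} \<and> layout (reduce \<phi>) u \<le> p \<and> p < layout (reduce \<phi>) v}
      \<le> num_vars \<phi> + 361" if "p \<in> {1..<card (verts (reduce \<phi>))}" for p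
  proof -
    have "{e \<in> ?E. \<exists>u v. e = {u, v} \<and> layout (reduce \<phi>) u \<le> p \<and> p < layout (reduce \<phi>) v}
      = {e \<in> ?E. \<exists>u v. e = {u, v} \<and> Suc u \<le> p \<and> p < Suc v}"
    proof (rule Collect_cong, rule conj_cong[OF refl])
      fix e assume "e \<in> ?E"
      then have "w < ?N" if "w \<in> e" for w
        using that graph_edges_less[of _ _ "num_vars \<phi>" "columns \<phi>"] unfolding edge_set_def by fastforce
      then have "layout (reduce \<phi>) w = Suc w" if "w \<in> e" for w using that layout_reduce by blast
      then show "(\<exists>u v. e = {u, v} \<and> layout (reduce \<phi>) u \<le> p \<and> p < layout (reduce \<phi>) v) \<longleftrightarrow>
        (\<exists>u v. e = {u, v} \<and> Suc u \<le> p \<and> p < Suc v)"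
        by (metis insertI1 insertI2)
    qed
    then show ?thesis using cut_bound[of p] that by simp
  qed
  then show ?thesis
    unfolding instance_cutwidth_def cutwidth_def reduce_sel(2) by (subst Max_le_iff) auto
qed

section \<open>Solving SAT through planar independent set\<close>

lemma exec_time_pos: "exec c s T s' \<Longrightarrow> T > 0"
  by (induction rule: exec.induct) auto

lemma exec_clear:
  "\<exists>c T. \<forall>s. exec c s T (\<lambda>x. if 0 < x \<and> x < k then Leaf else s x)"
proof (induction k)
  case 0
  show ?case by (intro exI[of _ Skip] exI[of _ 1]) (use exec.Skip in simp)
next
  case (Suc k)
  then obtain c T where c: "\<And>s. exec c s T (\<lambda>x. if 0 < x \<and> x < k then Leaf else s x)" by blast
  show ?case
  proof (cases "k = 0")
    case True
    then have "(\<lambda>x. if 0 < x \<and> x < Suc k then Leaf else s x) = s" for s :: store by auto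
    then show ?thesis using exec.Skip by metis
  next
    case False
    have "exec (Seq c (Assign k LeafE)) s (T + 1) (\<lambda>x. if 0 < x \<and> x < Suc k then Leaf else s x)" for s
    proof -
      let ?s = "\<lambda>x. if 0 < x \<and> x < k then Leaf else s x"
      have "?s(k := Leaf) = (\<lambda>x. if 0 < x \<and> x < Suc k then Leaf else s x)"
        using False by (auto simp: fun_eq_iff)
      then show ?thesis
        using exec.Seq[OF c[of s] exec.Assign[of k LeafE ?s]] by simp
    qed
    then show ?thesis by blast
  qed
qed

text \<open>A solver is only guaranteed to work from an \<open>initial_store\<close>. The scratch
  registers below k are therefore reset in constant time; from k on the frame condition keeps
  \<open>Leaf\<close>.\<close>

lemma polytime_clean:
  assumes "polytime f"
  shows "\<exists>c t. polybounded t \<and> (\<forall>d. \<exists>T. exec c (initial_store d) T (initial_store (f d)) \<and> T \<le> t d)"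
proof -
  obtain c k t where c: "polybounded t" "computes c k t f"
    using assms unfolding polytime_def by blast
  obtain c' T' where c': "\<And>s. exec c' s T' (\<lambda>x. if 0 < x \<and> x < k then Leaf else s x)"
    using exec_clear by blast
  have "\<exists>T. exec (Seq c c') (initial_store d) T (initial_store (f d)) \<and> T \<le> t d + T'" for d
  proof -
    obtain T s' where *: "exec c (initial_store d) T s'" "s' 0 = f (initial_store d 0)"
      "\<And>x. x \<ge> k \<Longrightarrow> s' x = initial_store d x" "T \<le> t (initial_store d 0)"
      by (rule computesD[OF c(2), where s = "initial_store d"]) blast
    have "(\<lambda>x. if 0 < x \<and> x < k then Leaf else s' x) = initial_store (f d)"
      using *(2,3) c(2) by (auto simp: initial_store_def fun_eq_iff computes_def)
    then have "exec (Seq c c') (initial_store d) (T + T') (initial_store (f d))"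
      using exec.Seq[OF *(1) c'[of s']] by simp
    then show ?thesis using *(4) by (auto simp: initial_store_def)
  qed
  moreover have "polybounded (\<lambda>d. t d + T')" using c(1) by (intro polybounded_add polybounded_const)
  ultimately show ?thesis by blast
qed

text \<open>The additive \<open>a\<close> enters only through the constant factor
  \<open>b ^ a\<close>; \<open>1 \<le> b\<close> allows replacing the parameter by its upper
  bound.\<close>

lemma solvable_Ostar_reduction:
  fixes b \<beta> :: real
  assumes r: "ptime enc enc' r"
    and I: "\<And>x. x \<in> I \<Longrightarrow> r x \<in> I'"
    and yes: "\<And>x. x \<in> I \<Longrightarrow> yes' (r x) \<longleftrightarrow> yes x"
    and par: "\<And>x. x \<in> I \<Longrightarrow> par' (r x) \<le> par x + a"
    and b: "1 \<le> b" "0 \<le> \<beta>" "\<beta> \<le> b"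
    and solv: "solvable_Ostar I' enc' yes' par' (\<lambda>k. \<beta> ^ k)"
  shows "solvable_Ostar I enc yes par (\<lambda>k. b ^ k)"
proof -
  obtain g where g: "polytime g" "\<And>x. g (enc x) = enc' (r x)" using r by (rule ptimeE) blast
  obtain c1 t where c1: "polybounded t"
    "\<And>d. \<exists>T. exec c1 (initial_store d) T (initial_store (g d)) \<and> T \<le> t d"
    using polytime_clean[OF g(1)] by blast
  obtain Ct dt where t: "\<And>d. t d \<le> Ct * data_size d ^ dt" using c1(1) unfolding polybounded_def by blast
  obtain Cg dg where gs: "\<And>d. data_size (g d) \<le> Cg * data_size d ^ dg"
    using polytime_size[OF g(1)] unfolding polybounded_def by blast
  obtain c C e where c: "\<And>x. x \<in> I' \<Longrightarrow> \<exists>T s. exec c (initial_store (enc' x)) T s \<and>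
      (s 0 \<noteq> Leaf \<longleftrightarrow> yes' x) \<and> real T \<le> C * \<beta> ^ par' x * real (data_size (enc' x)) ^ e"
    using solv unfolding solvable_Ostar_def by blast
  \<comment> \<open>The first summand pays for computing \<open>r\<close>, the second for the solver
    on its output; the absolute value is taken since the sign of \<open>C\<close> is
    unknown.\<close>
  define K where "K = real Ct + \<bar>C\<bar> * b ^ a * real Cg ^ e"
  define m where "m = dt + dg * e"
  have "\<exists>T s. exec (Seq c1 c) (initial_store (enc x)) T s \<and> (s 0 \<noteq> Leaf \<longleftrightarrow> yes x) \<and>
      real T \<le> K * b ^ par x * real (data_size (enc x)) ^ m" if x: "x \<in> I" for x
  proof -
    obtain T1 where T1: "exec c1 (initial_store (enc x)) T1 (initial_store (enc' (r x)))" "T1 \<le> t (enc x)"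
      using c1(2)[of "enc x"] g(2) by auto
    obtain T2 s where T2: "exec c (initial_store (enc' (r x))) T2 s" "s 0 \<noteq> Leaf \<longleftrightarrow> yes' (r x)"
      "real T2 \<le> C * \<beta> ^ par' (r x) * real (data_size (enc' (r x))) ^ e"
      using c[OF I[OF x]] by blast
    define z where "z = real (data_size (enc x))"
    have z: "1 \<le> z" using data_size_ge_1[of "enc x"] by (simp add: z_def)
    have bp: "1 \<le> b ^ par x" using b(1) by (rule one_le_power)
    have zm: "z ^ dt \<le> z ^ m" "z ^ (dg * e) \<le> z ^ m"
      using z by (auto simp: m_def intro: power_increasing)
    have "real T1 \<le> real (Ct * data_size (enc x) ^ dt)"
      using T1(2) t[of "enc x"] by (simp only: of_nat_le_iff)
    also have "\<dots> = real Ct * z ^ dt" by (simp add: z_def)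
    also have "\<dots> \<le> real Ct * (b ^ par x * z ^ m)"
      using zm(1) bp z by (intro mult_left_mono) (auto intro: order_trans[OF _ mult_mono[of 1 "b ^ par x" "z ^ dt" "z ^ m"]])
    finally have 1: "real T1 \<le> real Ct * (b ^ par x * z ^ m)" .
    have "\<beta> ^ par' (r x) \<le> b ^ par' (r x)" using b by (intro power_mono) auto
    also have "\<dots> \<le> b ^ (par x + a)" using b(1) par[OF x] by (intro power_increasing) auto
    finally have beta: "\<beta> ^ par' (r x) \<le> b ^ a * b ^ par x" by (simp add: power_add mult.commute)
    have "real (data_size (enc' (r x))) \<le> real (Cg * data_size (enc x) ^ dg)"
      using gs[of "enc x"] g(2) by (simp only: of_nat_le_iff)
    then have "real (data_size (enc' (r x))) ^ e \<le> (real Cg * z ^ dg) ^ e"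
      by (intro power_mono) (simp_all add: z_def)
    also have "\<dots> = real Cg ^ e * z ^ (dg * e)" by (simp add: power_mult_distrib power_mult)
    also have "\<dots> \<le> real Cg ^ e * z ^ m" using zm(2) by (intro mult_left_mono) auto
    finally have size: "real (data_size (enc' (r x))) ^ e \<le> real Cg ^ e * z ^ m" .
    have "real T2 \<le> C * (\<beta> ^ par' (r x) * real (data_size (enc' (r x))) ^ e)"
      using T2(3) by (simp add: mult.assoc)
    also have "\<dots> \<le> \<bar>C\<bar> * (\<beta> ^ par' (r x) * real (data_size (enc' (r x))) ^ e)"
      using b by (intro mult_right_mono) auto
    also have "\<dots> \<le> \<bar>C\<bar> * ((b ^ a * b ^ par x) * (real Cg ^ e * z ^ m))"
      using beta size b z by (intro mult_left_mono mult_mono) auto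
    finally have 2: "real T2 \<le> \<bar>C\<bar> * ((b ^ a * b ^ par x) * (real Cg ^ e * z ^ m))" .
    have "real (T1 + T2) \<le> K * b ^ par x * z ^ m"
      using 1 2 by (simp add: K_def algebra_simps)
    moreover have "exec (Seq c1 c) (initial_store (enc x)) (T1 + T2) s"
      by (rule exec.Seq[OF T1(1) T2(1)])
    ultimately show ?thesis using T2(2) yes[OF x] unfolding z_def by blast
  qed
  then show ?thesis unfolding solvable_Ostar_def by blast
qed

section \<open>Running time of the reduction\<close>

abbreviation enc_clause :: "clause \<Rightarrow> data" where
  "enc_clause \<equiv> enc_list (enc_pair enc_bool enc_nat)"

abbreviation enc_edge :: "nat \<times> nat \<Rightarrow> data" where
  "enc_edge \<equiv> enc_pair enc_nat enc_nat"

text \<open>Membership is expressed as nonemptiness of the list of hits, which needs only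
  concatenation, equality of booleans and numbers, and the test for \<open>[]\<close>.\<close>

lemma ptime_mem:
  assumes "ptime A enc_nat i" "ptime A enc_clause c"
  shows "ptime A enc_bool (\<lambda>x. (b, i x) \<in> set (c x))"
proof -
  have i: "ptime (enc_pair A B) enc_nat (\<lambda>p. i (fst p))" for B :: "'z \<Rightarrow> data"
    by (rule ptime_comp[OF _ assms(1)]) (rule ptime_intros)+
  have "ptime A (enc_list (\<lambda>_. Leaf))
      (\<lambda>x. concat (map (\<lambda>l. if fst l = b \<and> snd l = i x then [()] else []) (c x)))"
  proof (rule ptime_concat_map[OF assms(2)])
    show "ptime (enc_pair A (enc_pair enc_bool enc_nat)) (enc_list (\<lambda>_. Leaf))
      (\<lambda>p. if fst (snd p) = b \<and> snd (snd p) = i (fst p) then [()] else [])"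
      by (rule ptime_intros i)+
  qed
  then have "ptime A enc_bool
      (\<lambda>x. \<not> concat (map (\<lambda>l. if fst l = b \<and> snd l = i x then [()] else []) (c x)) = [])"
    by (intro ptime_Not ptime_null)
  moreover have "(\<not> concat (map (\<lambda>l. if fst l = b \<and> snd l = i then [()] else []) c) = []) \<longleftrightarrow>
      (b, i) \<in> set c" for i and c :: clause
    by (induction c) auto
  ultimately show ?thesis by simp
qed

lemma ptime_vid:
  assumes "ptime A enc_nat n" "ptime A enc_nat j" "ptime A enc_nat r" "ptime A enc_nat l"
  shows "ptime A enc_nat (\<lambda>x. vid (n x) (j x) (r x) (l x))"
  unfolding vid_def by (rule assms ptime_add ptime_mult ptime_diff ptime_const)+

lemma ptime_tile_wires:
  assumes "ptime A enc_clause c" "ptime A enc_nat i"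
  shows "ptime A (enc_list enc_edge) (\<lambda>x. tile_wires (c x) (i x))"
  unfolding tile_wires_def
  by (rule ptime_append ptime_If ptime_mem[OF assms(2,1)] ptime_const)+

text \<open>\<open>ptime\<close> demands agreement on all arguments, but \<open>!\<close> is
  unspecified beyond the end of the list; this total variant agrees with it at every index
  used.\<close>

definition clause_at :: "clause list \<Rightarrow> nat \<Rightarrow> clause" where
  "clause_at D j = (case drop j D of [] \<Rightarrow> [] | c # _ \<Rightarrow> c)"

lemma clause_at_eq: "j < length D \<Longrightarrow> clause_at D j = D ! j"
  by (simp add: clause_at_def flip: Cons_nth_drop_Suc)

lemma ptime_clause_at:
  assumes "ptime A (enc_list enc_clause) D" "ptime A enc_nat j"
  shows "ptime A enc_clause (\<lambda>x. clause_at (D x) (j x))"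
  unfolding clause_at_def by (rule ptime_hd ptime_drop assms)+

lemma ptime_tile_edges:
  "ptime (enc_pair enc_nat (enc_list enc_clause)) (enc_list enc_edge) (\<lambda>p. tile_edges (fst p) (snd p))"
proof -
  have "tile_edges n D = concat (map (\<lambda>j. concat (map (\<lambda>i.
     map (\<lambda>p. (vid n j (Suc i) (fst p), vid n j (Suc i) (snd p))) (tile_wires (clause_at D j) i))
     [0..<n])) [0..<length D])" for n D
    unfolding tile_edges_def
    by (intro arg_cong[of _ _ concat] map_cong refl) (simp add: clause_at_eq)
  then show ?thesis
    by (simp only:)
       (rule ptime_concat_map[where B = enc_nat] ptime_map[where B = enc_edge] ptime_upt ptime_length
         ptime_tile_wires ptime_clause_at ptime_Pair ptime_vid ptime_Suc ptime_fst ptime_snd ptime_id)+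
qed

lemma ptime_vertical_edges:
  "ptime (enc_pair enc_nat enc_nat) (enc_list enc_edge) (\<lambda>p. vertical_edges (fst p) (snd p))"
  unfolding vertical_edges_def
  by (rule ptime_concat_map[where B = enc_nat] ptime_map[where B = enc_nat] ptime_upt
         ptime_Pair ptime_vid ptime_Suc ptime_fst ptime_snd ptime_id ptime_const)+

lemma ptime_horizontal_edges:
  "ptime (enc_pair enc_nat enc_nat) (enc_list enc_edge) (\<lambda>p. horizontal_edges (fst p) (snd p))"
  unfolding horizontal_edges_def
  by (rule ptime_concat_map[where B = enc_nat] ptime_map[where B = enc_nat] ptime_upt
         ptime_Pair ptime_vid ptime_Suc ptime_diff ptime_fst ptime_snd ptime_id ptime_const)+

lemma ptime_reduce: "ptime enc_cnf enc_instance reduce"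
proof -
  let ?A = "enc_pair enc_nat (enc_list enc_clause)"
  let ?B = "enc_pair enc_nat (enc_pair (enc_list enc_edge) (enc_pair (enc_list enc_nat) enc_nat))"
  define N where "N p = length (snd p) * (20 * fst p + 2)" for p :: "nat \<times> clause list"
  \<comment> \<open>Once n is paired with the repeated clause list, every component of the output is
    a function of that pair.\<close>
  have cols: "ptime ?A ?A (\<lambda>p. (fst p, concat (map (\<lambda>_. snd p) [0..<Suc (fst p)])))"
    by (rule ptime_concat_map[where B = enc_nat] ptime_Pair ptime_upt ptime_Suc ptime_fst ptime_snd ptime_id)+
  have N: "ptime ?A enc_nat N"
    unfolding N_def
    by (rule ptime_add ptime_mult ptime_length ptime_fst ptime_snd ptime_id ptime_const)+
  have T: "ptime ?A enc_nat (\<lambda>p. length (snd p) * (8 * fst p + 2))"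
    by (rule ptime_add ptime_mult ptime_length ptime_fst ptime_snd ptime_id ptime_const)+
  have nl: "ptime ?A enc_edge (\<lambda>p. (fst p, length (snd p)))"
    by (rule ptime_Pair ptime_length ptime_fst ptime_snd ptime_id)+
  have E: "ptime ?A (enc_list enc_edge) (\<lambda>p. graph_edges (fst p) (snd p))"
    unfolding graph_edges_def
    using ptime_comp[OF nl ptime_vertical_edges] ptime_comp[OF nl ptime_horizontal_edges]
    by (intro ptime_append ptime_tile_edges) simp_all
  have P: "ptime ?A (enc_list enc_nat) (\<lambda>p. map Suc [0..<N p])"
    by (rule ptime_map[where B = enc_nat] ptime_upt[OF N] ptime_Suc ptime_snd ptime_id)+
  have "ptime ?A ?B (\<lambda>p. (N p, graph_edges (fst p) (snd p), map Suc [0..<N p], length (snd p) * (8 * fst p + 2)))"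
    by (rule ptime_Pair N E P T)+
  from ptime_comp[OF cols this] obtain g where g: "polytime g"
    "\<And>p. g (?A p) = ?B (let D = concat (map (\<lambda>_. snd p) [0..<Suc (fst p)]); p' = (fst p, D) in
      (N p', graph_edges (fst p') D, map Suc [0..<N p'], length D * (8 * fst p' + 2)))"
    unfolding ptime_def Let_def by auto
  show ?thesis
  proof (rule ptimeI[OF g(1)])
    fix \<phi>
    show "g (enc_cnf \<phi>) = enc_instance (reduce \<phi>)"
      unfolding enc_cnf_def g(2) enc_instance_def reduce_def columns_def N_def Let_def
      by (simp del: upt_Suc enc_pair.simps)
  qed
qed

text \<open>Instances of cutwidth 0 and, below, 1: their positive running times force
  \<open>C > 0\<close> and \<open>C * (2 - \<epsilon>) > 0\<close> for any claimed bound.\<close>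

lemma trivial_instance: "IS_Instance 0 [] [] 0 \<in> planar_layout_inputs"
  "instance_cutwidth (IS_Instance 0 [] [] 0) = 0"
proof -
  have "planar {} {}" unfolding planar_def plane_drawing_def by auto
  then show "IS_Instance 0 [] [] 0 \<in> planar_layout_inputs"
    by (simp add: planar_layout_inputs_def verts_def edges_def simple_graph_def linear_layout_def bij_betw_def)
  show "instance_cutwidth (IS_Instance 0 [] [] 0) = 0"
    by (simp add: instance_cutwidth_def cutwidth_def verts_def)
qed

lemma edge_instance: "IS_Instance 2 [(0, 1)] [1, 2] 0 \<in> planar_layout_inputs" (is "?x \<in> _")
  "instance_cutwidth (IS_Instance 2 [(0, 1)] [1, 2] 0) = 1"
proof -
  have V: "verts ?x = {0, 1}" and E: "edges ?x = {{0, 1}}"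
    by (auto simp: verts_def edges_def)
  have l: "layout ?x 0 = 1" "layout ?x 1 = 2" by (simp_all add: layout_def)
  have "planar {0, 1 :: nat} {{0, 1}}"
  proof (rule straight_line_planar[where p = "\<lambda>v. (real v, 0)"])
    show "inj_on (\<lambda>v. (real v, 0 :: real)) {0, 1}" by (auto simp: inj_on_def)
  qed (auto simp: doubleton_eq_iff)
  moreover have "simple_graph {0, 1 :: nat} {{0, 1}}" by (auto simp: simple_graph_def)
  moreover have "linear_layout {0, 1} (layout ?x)"
    using l by (auto simp: linear_layout_def bij_betw_def inj_on_def)
  ultimately show "?x \<in> planar_layout_inputs"
    unfolding planar_layout_inputs_def mem_Collect_eq V E by simp
  have "\<exists>u v. {0, 1 :: nat} = {u, v} \<and> layout ?x u \<le> 1 \<and> 1 < layout ?x v"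
    by (rule exI[of _ 0], rule exI[of _ 1]) (simp add: l del: One_nat_def)
  then have "{e \<in> {{0, 1 :: nat}}. \<exists>u v. e = {u, v} \<and> layout ?x u \<le> 1 \<and> 1 < layout ?x v} = {{0, 1}}"
    by blast
  moreover have "{1..<card {0, 1 :: nat}} = {1}" by auto
  ultimately show "instance_cutwidth ?x = 1"
    unfolding instance_cutwidth_def cutwidth_def V E by simp
qed

theorem theorem1:
  assumes SETH
  shows "\<not> (\<exists>\<epsilon>::real. \<epsilon> > 0 \<and>
    solvable_Ostar planar_layout_inputs enc_instance has_independent_set instance_cutwidth
      (\<lambda>k. (2 - \<epsilon>) ^ k))"
proof
  assume "\<exists>\<epsilon>::real. \<epsilon> > 0 \<and>
    solvable_Ostar planar_layout_inputs enc_instance has_independent_set instance_cutwidth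
      (\<lambda>k. (2 - \<epsilon>) ^ k)"
  then obtain \<epsilon> :: real where eps: "\<epsilon> > 0" and
    solv: "solvable_Ostar planar_layout_inputs enc_instance has_independent_set instance_cutwidth
      (\<lambda>k. (2 - \<epsilon>) ^ k)" by blast
  \<comment> \<open>The reduction needs a nonnegative base. For \<epsilon> \<ge> 2 the claimed bound
    would be nonpositive at cutwidth 0 or 1, yet every run takes a step.\<close>
  have "\<epsilon> < 2"
  proof (rule ccontr)
    assume ge: "\<not> \<epsilon> < 2"
    obtain C d where "\<And>x. x \<in> planar_layout_inputs \<Longrightarrow>
        \<exists>T>0. real T \<le> C * (2 - \<epsilon>) ^ instance_cutwidth x * real (data_size (enc_instance x)) ^ d"
      using solv exec_time_pos unfolding solvable_Ostar_def by metis
    note this[OF trivial_instance(1), unfolded trivial_instance(2)]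
      this[OF edge_instance(1), unfolded edge_instance(2)]
    then obtain T T' :: nat and a b :: real where "T > 0" "real T \<le> C * a" "a > 0"
      "T' > 0" "real T' \<le> C * (2 - \<epsilon>) * b" "b > 0"
      by (metis data_size_pos mult.right_neutral of_nat_0_less_iff power_0 power_one_right zero_less_power)
    then have "0 < C * a" "0 < C * (2 - \<epsilon>) * b" by linarith+
    then have "C > 0" "C * (2 - \<epsilon>) > 0" using \<open>a > 0\<close> \<open>b > 0\<close> by (auto simp: zero_less_mult_iff)
    then show False using ge by (simp add: zero_less_mult_iff)
  qed
  \<comment> \<open>The cap at 1 keeps \<open>2 - \<delta>\<close> at least 1, as the reduction
    lemma requires, and still at least \<open>2 - \<epsilon>\<close>.\<close>
  define \<delta> where "\<delta> = min 1 \<epsilon>"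
  have "\<delta> > 0" using eps by (simp add: \<delta>_def)
  then obtain q where q: "\<not> solvable_Ostar (qSAT_inputs q) enc_cnf satisfiable num_vars (\<lambda>n. (2 - \<delta>) ^ n)"
    using assms unfolding SETH_def by blast
  have "solvable_Ostar (qSAT_inputs q) enc_cnf satisfiable num_vars (\<lambda>n. (2 - \<delta>) ^ n)"
    by (rule solvable_Ostar_reduction[OF ptime_reduce reduce_input reduce_correct reduce_cutwidth _ _ _ solv])
      (use \<open>\<epsilon> < 2\<close> in \<open>auto simp: \<delta>_def\<close>)
  with q show False by blast
qed

end
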